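(* Let $n\ge2$, $0<s<1$, $1<p<2$ and $sp>p-1$. Let $U$ be a globally Lipschitz entire weak solution of $$\operatorname{P.V.}\int_{\mathbb R^n}\frac{J_p(U(x)-U(y))}{|x-y|^{n+sp}}\,dy=0\quad\text{in }\mathbb R^n,$$ and write $L:=[U]_{C^{0,1}(\mathbb R^n)}$ for its global Lipschitz seminorm. If there are distinct points $a,b\in\mathbb R^n$ such that $|U(b)-U(a)|=L|b-a|$, then $U$ is affine.
   Context: $J_p(t):=|t|^{p-2}t$ for $t\in\mathbb R$ (with $J_p(0)=0$). The tail space $L^{p-1}_{sp}(\mathbb R^n)$ consists of all $v\in L^{p-1}_{\rm loc}(\mathbb R^n)$ with $\int_{\mathbb R^n}|v(y)|^{p-1}(1+|y|)^{-n-sp}\,dy<\infty$. An entire weak solution is a function $U\in W^{s,p}_{\rm loc}(\mathbb R^n)\cap L^{p-1}_{sp}(\mathbb R^n)$ with $$\iint_{\mathbb R^n\times\mathbb R^n}\frac{J_p(U(x)-U(y))(\varphi(x)-\varphi(y))}{|x-y|^{n+sp}}\,dx\,dy=0\quad\text{for every }\varphi\in C_c^\infty(\mathbb R^n).$$ *)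

theory Defs
  imports "HOL-Analysis.Analysis"
begin

definition J :: "real \<Rightarrow> real \<Rightarrow> real" where
  "J p t = \<bar>t\<bar> powr (p - 2) * t"

definition L_loc :: "real \<Rightarrow> ('a::euclidean_space \<Rightarrow> real) set" where
  "L_loc q = {v. v \<in> borel_measurable lebesgue \<and>
     (\<forall>K. compact K \<longrightarrow> set_integrable lebesgue K (\<lambda>x. \<bar>v x\<bar> powr q))}"

definition tail_space :: "real \<Rightarrow> real \<Rightarrow> ('a::euclidean_space \<Rightarrow> real) set" where
  "tail_space s p = {v. v \<in> L_loc (p - 1) \<and>
     integrable lebesgue
       (\<lambda>y. \<bar>v y\<bar> powr (p - 1) * (1 + norm y) powr (- real DIM('a) - s * p))}"

text \<open>Since \<open>0 powr r = 0\<close> and \<open>t / 0 = 0\<close>, the integrands with kernel \<open>norm (x - y) powr - (n + s p)\<close>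
  below take the value 0 on the (null) diagonal.\<close>

definition W_sp :: "real \<Rightarrow> real \<Rightarrow> 'a::euclidean_space set \<Rightarrow> ('a \<Rightarrow> real) set" where
  "W_sp s p \<Omega> = {u. set_borel_measurable lebesgue \<Omega> u \<and>
     set_integrable lebesgue \<Omega> (\<lambda>x. \<bar>u x\<bar> powr p) \<and>
     set_integrable lebesgue (\<Omega> \<times> \<Omega>)
       (\<lambda>(x, y). \<bar>u x - u y\<bar> powr p / norm (x - y) powr (real DIM('a) + s * p))}"

definition W_sp_loc :: "real \<Rightarrow> real \<Rightarrow> ('a::euclidean_space \<Rightarrow> real) set" where
  "W_sp_loc s p = {u. \<forall>\<Omega>. open \<Omega> \<and> bounded \<Omega> \<longrightarrow> u \<in> W_sp s p \<Omega>}"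

primrec C_k :: "nat \<Rightarrow> ('a::euclidean_space \<Rightarrow> real) \<Rightarrow> bool" where
  "C_k 0 f \<longleftrightarrow> continuous_on UNIV f"
| "C_k (Suc k) f \<longleftrightarrow> (\<forall>x. f differentiable (at x)) \<and>
     (\<forall>e\<in>Basis. C_k k (\<lambda>x. frechet_derivative f (at x) e))"

definition test_functions :: "('a::euclidean_space \<Rightarrow> real) set" where
  "test_functions = {\<phi>. (\<forall>k. C_k k \<phi>) \<and> compact (closure {x. \<phi> x \<noteq> 0})}"

text \<open>The double integral is taken over the product space. For \<open>U\<close> in the two function spaces it
  converges absolutely; \<open>has_bochner_integral\<close> rather than an equation between integrals rules out
  the default value 0 of \<open>integral\<^sup>L\<close> at non-integrable functions.\<close>

definition entire_weak_solution :: "real \<Rightarrow> real \<Rightarrow> ('a::euclidean_space \<Rightarrow> real) \<Rightarrow> bool" where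
  "entire_weak_solution s p U \<longleftrightarrow>
     U \<in> W_sp_loc s p \<and> U \<in> tail_space s p \<and>
     (\<forall>\<phi>\<in>test_functions.
        has_bochner_integral lebesgue
          (\<lambda>(x, y). J p (U x - U y) * (\<phi> x - \<phi> y) / norm (x - y) powr (real DIM('a) + s * p)) 0)"

definition globally_lipschitz :: "('a::euclidean_space \<Rightarrow> real) \<Rightarrow> bool" where
  "globally_lipschitz U \<longleftrightarrow> (\<exists>C. C-lipschitz_on UNIV U)"

text \<open>A supremum in \<open>real\<close>: meaningful for globally Lipschitz \<open>U\<close> only.\<close>

definition lipschitz_seminorm :: "('a::euclidean_space \<Rightarrow> real) \<Rightarrow> real" where
  "lipschitz_seminorm U = (SUP (x, y)\<in>{(x, y). x \<noteq> y}. \<bar>U x - U y\<bar> / norm (x - y))"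

end

theory Submission
  imports Defs
begin

text \<open>Along the segment from \<open>a\<close> to \<open>b\<close> the function \<open>U\<close> has slope \<open>L\<close>, and the cones with vertices \<open>a\<close>
  and \<open>b\<close> squeeze it at every interior point between smooth functions with nonzero gradient. Hence the
  weak equation holds there in the viscosity sense, and since the singularity \<open>\<bar>\<xi> \<bullet> z\<bar> powr (p - 2)\<close>
  is integrable for \<open>p > 1\<close>, it holds pointwise. Subtracting the equations at two interior points
  whose difference is \<open>h\<close>, where the integrand has a sign because \<open>U (x + h) \<le> U x + L * norm h\<close>, gives
  \<open>U (x + h) = U x + L * norm h\<close> for all \<open>x\<close>. Iterating this translation along \<open>h\<close>, the Lipschitz
  bound leaves no freedom transversally to \<open>h\<close>.\<close>

subsection \<open>The nonlinearity\<close>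

text \<open>With n the dimension, the Lipschitz bound on the integrand is a multiple of |z|^(p - 1 -
  n - s p): integrable at infinity because s p > p - 1, but for the same reason not near 0. So no
  principal value is formed. The operator is cut off at |z| >= r, and the cut-off integral is shown
  to have a sign up to an error C r^(p - s p), which tends to 0 since s < 1. This power comes from a
  paraboloid of slope \<xi>: its odd part cancels between z and - z and leaves |z|^2 |\<xi> . z|^(p
  - 2) / |z|^(n + s p). With slope 0 one would face |z|^(2 p - 2 - n - s p) instead, which need not
  be integrable.

  One inequality per point is enough. At the point nearer \<open>a\<close> the lower cone with
  vertex \<open>b\<close> gives a lower bound; at the other one the upper cone with vertex
  \<open>a\<close> gives an upper bound, obtained by passing to - U. Together they bound the
  nonnegative difference from above.

  The test function that lifts the paraboloid towards U is only Lipschitz, while the weak equation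
  is stated for smooth ones; hence the mollification.\<close>

lemma powr_add_le_add_powr:
  fixes x y q :: real
  assumes "0 \<le> x" "0 \<le> y" "0 < q" "q \<le> 1"
  shows "(x + y) powr q \<le> x powr q + y powr q"
proof (cases "x + y = 0")
  case True
  then show ?thesis using assms by simp
next
  case False
  then have pos: "x + y > 0" using assms by simp
  have ge: "t \<le> t powr q" if "0 \<le> t" "t \<le> 1" for t :: real
    using powr_mono'[of q 1 t] that assms by (cases "t = 0") auto
  \<comment> \<open>By homogeneity it suffices to treat two fractions with sum 1, and
    \<open>ge\<close> applies to each of them.\<close>
  have "1 = x / (x + y) + y / (x + y)" using pos by (simp add: add_divide_distrib[symmetric])
  also have "\<dots> \<le> (x / (x + y)) powr q + (y / (x + y)) powr q"
    using ge[of "x / (x + y)"] ge[of "y / (x + y)"] assms pos by (intro add_mono) auto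
  also have "\<dots> = (x powr q + y powr q) / (x + y) powr q"
    using assms pos by (simp add: powr_divide add_divide_distrib)
  finally show ?thesis using pos by (simp add: field_simps)
qed

lemma J_of_nonneg: "0 \<le> t \<Longrightarrow> J p t = t powr (p - 1)"
  using powr_add[of t "p - 2" 1] by (cases "t = 0") (auto simp: J_def)

lemma J_minus: "J p (- t) = - J p t"
  by (simp add: J_def)

lemma abs_J: "\<bar>J p t\<bar> = \<bar>t\<bar> powr (p - 1)"
  using J_of_nonneg[of "\<bar>t\<bar>" p] by (simp add: J_def abs_mult)

lemma J_strict_mono: "1 < p \<Longrightarrow> strict_mono (J p)"
proof (rule strict_monoI)
  fix x y :: real assume "1 < p" "x < y"
  consider "0 \<le> x" | "y \<le> 0" | "x < 0" "0 < y" by linarith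
  then show "J p x < J p y"
  proof cases
    case 1
    then show ?thesis using \<open>1 < p\<close> \<open>x < y\<close> by (simp add: J_of_nonneg powr_less_mono2)
  next
    case 2
    then have "J p (- y) < J p (- x)"
      using \<open>1 < p\<close> \<open>x < y\<close> by (simp add: J_of_nonneg powr_less_mono2)
    then show ?thesis by (simp add: J_minus)
  next
    case 3
    then show ?thesis by (smt (verit, best) J_def mult_pos_pos mult_pos_neg powr_gt_zero)
  qed
qed

lemma J_mono: "1 < p \<Longrightarrow> x \<le> y \<Longrightarrow> J p x \<le> J p y"
  using J_strict_mono[of p] by (simp add: strict_mono_less_eq)

text \<open>Avoids the negative exponent \<open>p - 2\<close> of the definition, so that continuity
  at 0 follows from that of \<open>powr\<close> with a positive exponent.\<close>

lemma J_eq_max: "1 < p \<Longrightarrow> J p t = max t 0 powr (p - 1) - max (- t) 0 powr (p - 1)"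
  using J_of_nonneg[of t p] J_of_nonneg[of "- t" p] J_minus[of p t] by (cases "0 \<le> t") auto

lemma continuous_on_J:
  assumes "1 < p" "continuous_on A f"
  shows "continuous_on A (\<lambda>x. J p (f x))"
  unfolding J_eq_max[OF assms(1)]
  by (intro continuous_intros continuous_on_powr' assms(2)) (use assms in auto)

lemma borel_measurable_J [measurable]: "J p \<in> borel_measurable borel"
  unfolding J_def[abs_def] by measurable

text \<open>Hoelder continuity with exponent \<open>p - 1\<close>. The factor 2 comes from the case
  of a sign change, where the positive and the negative part each contribute at most
  \<open>w powr (p - 1)\<close>.\<close>

lemma J_add_diff_le:
  assumes p: "1 < p" "p < 2" and w: "0 \<le> w"
  shows "J p (a + w) - J p a \<le> 2 * w powr (p - 1)"
proof -
  have nn: "0 \<le> w powr (p - 1)" by simp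
  consider "0 \<le> a" | "a + w \<le> 0" | "a < 0" "0 < a + w" by linarith
  then show ?thesis
  proof cases
    case 1
    then show ?thesis
      using powr_add_le_add_powr[of a w "p - 1"] p w nn unfolding J_of_nonneg[OF 1]
      by (subst J_of_nonneg) linarith+
  next
    case 2
    then have "J p (- a) - J p (- (a + w)) \<le> w powr (p - 1)"
      using powr_add_le_add_powr[of "- (a + w)" w "p - 1"] p w by (simp add: J_of_nonneg)
    then have "J p (a + w) - J p a \<le> w powr (p - 1)" by (simp only: J_minus)
    then show ?thesis using nn by linarith
  next
    case 3
    have "J p (a + w) \<le> w powr (p - 1)" "J p (- a) \<le> w powr (p - 1)"
      using 3 p by (auto simp: J_of_nonneg intro!: powr_mono2)
    then show ?thesis by (simp add: J_minus)
  qed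
qed

text \<open>The cancellation behind the near-field estimate, used with \<open>d\<close> quadratic
  and \<open>a\<close> linear in \<open>z\<close>: since \<open>J p\<close> is odd, only a term
  linear in \<open>d\<close> survives. If \<open>d \<le> \<bar>a\<bar>\<close>, scaling reduces to t
  = d / |a| in [0, 1], where (1 + t)^(p - 1) - (1 - t)^(p - 1) <= 2 t. Otherwise the sum is at most
  3 d^(p - 1), and d^(p - 2) <= |a|^(p - 2) as the exponent is negative. The value
  \<open>a = 0\<close> is excluded because \<open>0 powr (p - 2) = 0\<close> would make the
  right-hand side vanish.\<close>

lemma J_add_sum_le:
  assumes p: "1 < p" "p < 2" and a: "a \<noteq> 0" and d: "0 \<le> d"
  shows "J p (d + a) + J p (d - a) \<le> 3 * d * \<bar>a\<bar> powr (p - 2)"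
proof -
  have *: "J p (d + a) + J p (d - a) \<le> 3 * d * a powr (p - 2)" if a: "0 < a" for a
  proof (cases "d \<le> a")
    case True
    define t where "t = d / a"
    have t: "0 \<le> t" "t \<le> 1" "d = t * a" using True d a by (auto simp: t_def)
    have 1: "(1 + t) powr (p - 1) \<le> 1 + t"
      using powr_mono[of "p - 1" 1 "1 + t"] p t by auto
    have 2: "1 - t \<le> (1 - t) powr (p - 1)"
      using powr_mono'[of "p - 1" 1 "1 - t"] p t by (cases "t = 1") auto
    have 3: "J p (d + a) = (1 + t) powr (p - 1) * a powr (p - 1)"
      using t a by (simp add: J_of_nonneg powr_mult[symmetric] algebra_simps)
    have "J p (a - d) = (1 - t) powr (p - 1) * a powr (p - 1)"
      using t a True by (simp add: J_of_nonneg powr_mult[symmetric] algebra_simps)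
    then have 4: "J p (d - a) = - ((1 - t) powr (p - 1) * a powr (p - 1))"
      using J_minus[of p "a - d"] by simp
    have "J p (d + a) + J p (d - a) = ((1 + t) powr (p - 1) - (1 - t) powr (p - 1)) * a powr (p - 1)"
      unfolding 3 4 by (simp add: algebra_simps)
    also have "\<dots> \<le> (2 * t) * a powr (p - 1)" using 1 2 by (intro mult_right_mono) auto
    also have "\<dots> \<le> (3 * t) * a powr (p - 1)" using t by (intro mult_right_mono) auto
    also have "\<dots> = 3 * d * a powr (p - 2)"
      using powr_add[of a "p - 2" 1] a t by simp
    finally show ?thesis .
  next
    case False
    have "J p (d + a) + J p (d - a) \<le> J p (d + d) + J p d"
      using False a p by (intro add_mono J_mono) auto
    also have "\<dots> \<le> 3 * d powr (p - 1)"
      using J_add_diff_le[OF p d, of d] powr_add_le_add_powr[of d d "p - 1"] d p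
      by (simp add: J_of_nonneg)
    also have "\<dots> = 3 * d * d powr (p - 2)"
      using powr_add[of d "p - 2" 1] False a by simp
    also have "\<dots> \<le> 3 * d * a powr (p - 2)"
      using False a p d by (intro mult_left_mono powr_mono2') auto
    finally show ?thesis .
  qed
  show ?thesis
    using *[of a] *[of "- a"] a by (cases "0 < a") (auto simp: add.commute)
qed

subsection \<open>Homogeneous integrals\<close>

lemma lborel_affine_isometry:
  assumes "c = 1 \<or> c = - 1"
  shows "distr lborel borel (\<lambda>x. t + c *\<^sub>R x) = (lborel :: 'a::euclidean_space measure)"
  using lborel_affine[of c t] assms by (auto simp: density_1)

lemma
  fixes f :: "'a::euclidean_space \<Rightarrow> 'b::{banach, second_countable_topology}"
  assumes [measurable]: "f \<in> borel_measurable borel" and c: "c = 1 \<or> c = - 1"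
  shows integrable_lborel_affine_iff: "integrable lborel (\<lambda>x. f (t + c *\<^sub>R x)) \<longleftrightarrow> integrable lborel f"
    and integral_lborel_affine: "(\<integral>x. f (t + c *\<^sub>R x) \<partial>lborel) = (\<integral>x. f x \<partial>lborel)"
proof -
  have T: "(\<lambda>x. t + c *\<^sub>R x) \<in> measurable lborel borel" by simp
  show "integrable lborel (\<lambda>x. f (t + c *\<^sub>R x)) \<longleftrightarrow> integrable lborel f"
    by (subst (2) lborel_affine_isometry[OF c, of t, symmetric], subst integrable_distr_eq[OF T]) auto
  show "(\<integral>x. f (t + c *\<^sub>R x) \<partial>lborel) = (\<integral>x. f x \<partial>lborel)"
    by (subst (2) lborel_affine_isometry[OF c, of t, symmetric], subst integral_distr[OF T]) auto
qed

lemma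
  fixes f :: "'a::euclidean_space \<Rightarrow> 'b::{banach, second_countable_topology}"
  assumes "f \<in> borel_measurable borel"
  shows integral_lborel_translate: "(\<integral>x. f (t + x) \<partial>lborel) = (\<integral>x. f x \<partial>lborel)"
    and integrable_lborel_reflect: "integrable lborel (\<lambda>x. f (t - x)) \<longleftrightarrow> integrable lborel f"
    and integral_lborel_reflect: "(\<integral>x. f (t - x) \<partial>lborel) = (\<integral>x. f x \<partial>lborel)"
  using integral_lborel_affine[OF assms, of 1 t]
    integrable_lborel_affine_iff[OF assms, of "-1" t] integral_lborel_affine[OF assms, of "-1" t]
  by auto

lemma nn_integral_lborel_affine:
  fixes f :: "'a::euclidean_space \<Rightarrow> ennreal"
  assumes [measurable]: "f \<in> borel_measurable borel" and c: "c \<noteq> 0"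
  shows "(\<integral>\<^sup>+x. f x \<partial>lborel) = ennreal (\<bar>c\<bar> ^ DIM('a)) * (\<integral>\<^sup>+x. f (t + c *\<^sub>R x) \<partial>lborel)"
  by (subst lborel_affine[OF c, of t])
     (simp add: nn_integral_density nn_integral_distr nn_integral_cmult)

definition shell :: "real \<Rightarrow> 'a::euclidean_space set" where
  "shell r = {z. r \<le> norm z \<and> norm z < 2 * r}"

lemma shell_measurable [measurable]: "shell r \<in> sets borel"
  unfolding shell_def by measurable

lemma nn_integral_homogeneous_scale:
  fixes f :: "'a::euclidean_space \<Rightarrow> ennreal"
  assumes [measurable]: "f \<in> borel_measurable borel"
    and A [measurable]: "A \<in> sets borel" "B \<in> sets borel"
    and hom: "\<And>c z. 0 < c \<Longrightarrow> f (c *\<^sub>R z) = ennreal (c powr d) * f z"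
    and c: "0 < c" and AB: "\<And>z. c *\<^sub>R z \<in> A \<longleftrightarrow> z \<in> B"
  shows "(\<integral>\<^sup>+z. f z * indicator A z \<partial>lborel) =
    ennreal (c powr (real DIM('a) + d)) * (\<integral>\<^sup>+z. f z * indicator B z \<partial>lborel)"
proof -
  have ind: "indicator A (c *\<^sub>R z) = (indicator B z :: ennreal)" for z
    using AB[of z] by (simp add: indicator_def)
  have "(\<integral>\<^sup>+z. f z * indicator A z \<partial>lborel) =
      ennreal (\<bar>c\<bar> ^ DIM('a)) * (\<integral>\<^sup>+z. ennreal (c powr d) * (f z * indicator B z) \<partial>lborel)"
    using c hom[OF c] ind
    by (subst nn_integral_lborel_affine[of _ c 0]) (auto simp: mult.assoc)
  also have "\<dots> = (ennreal (\<bar>c\<bar> ^ DIM('a)) * ennreal (c powr d)) * (\<integral>\<^sup>+z. f z * indicator B z \<partial>lborel)"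
    by (subst nn_integral_cmult) (auto simp: mult.assoc)
  also have "ennreal (\<bar>c\<bar> ^ DIM('a)) * ennreal (c powr d) = ennreal (c powr (real DIM('a) + d))"
    using c by (simp add: ennreal_mult[symmetric] powr_add powr_realpow)
  finally show ?thesis .
qed

text \<open>The integrals over the shells of radii \<rho>^k form a geometric series whose ratio is
  \<rho> to the power dimension plus degree. Taking \<rho> = 2 controls infinity and \<rho> = 1/2
  controls the origin, so everything reduces to the single shell between 1 and 2.\<close>

lemma nn_integral_homogeneous_le:
  fixes f :: "'a::euclidean_space \<Rightarrow> ennreal"
  assumes [measurable]: "f \<in> borel_measurable borel"
    and hom: "\<And>c z. 0 < c \<Longrightarrow> f (c *\<^sub>R z) = ennreal (c powr d) * f z"
    and \<rho>: "0 < \<rho>" "\<rho> powr (real DIM('a) + d) < 1"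
    and sub: "S \<subseteq> (\<Union>k. shell (\<rho> ^ k))"
  shows "(\<integral>\<^sup>+z. f z * indicator S z \<partial>lborel) \<le>
    ennreal (1 / (1 - \<rho> powr (real DIM('a) + d))) * (\<integral>\<^sup>+z. f z * indicator (shell 1) z \<partial>lborel)"
proof -
  define q where "q = \<rho> powr (real DIM('a) + d)"
  have q: "0 \<le> q" "q < 1" using \<rho> by (auto simp: q_def)
  define I where "I = (\<integral>\<^sup>+z. f z * indicator (shell 1) z \<partial>lborel)"
  have pw: "f z * indicator S z \<le> (\<Sum>k. f z * indicator (shell (\<rho> ^ k)) z)" for z
  proof (cases "z \<in> S")
    case True
    then obtain k where "z \<in> shell (\<rho> ^ k)" using sub by blast
    then have "f z * indicator S z = (\<Sum>k\<in>{k}. f z * indicator (shell (\<rho> ^ k)) z)" using True by simp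
    also have "\<dots> \<le> (\<Sum>k. f z * indicator (shell (\<rho> ^ k)) z)"
      by (rule sum_le_suminf) auto
    finally show ?thesis .
  qed simp
  have "(\<integral>\<^sup>+z. f z * indicator (shell (\<rho> ^ k)) z \<partial>lborel) = ennreal ((\<rho> ^ k) powr (real DIM('a) + d)) * I" for k
    unfolding I_def using \<rho> hom by (intro nn_integral_homogeneous_scale) (auto simp: shell_def)
  moreover have "(\<rho> ^ k) powr (real DIM('a) + d) = q ^ k" for k
    using \<rho> by (simp add: q_def powr_realpow[symmetric] powr_powr mult.commute)
  ultimately have k: "(\<integral>\<^sup>+z. f z * indicator (shell (\<rho> ^ k)) z \<partial>lborel) = ennreal (q ^ k) * I" for k
    by simp
  have "(\<integral>\<^sup>+z. f z * indicator S z \<partial>lborel) \<le> (\<integral>\<^sup>+z. (\<Sum>k. f z * indicator (shell (\<rho> ^ k)) z) \<partial>lborel)"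
    by (intro nn_integral_mono pw)
  also have "\<dots> = (\<Sum>k. ennreal (q ^ k) * I)"
    by (subst nn_integral_suminf) (auto simp: k)
  also have "\<dots> = ennreal (1 / (1 - q)) * I"
    using q by (simp add: suminf_geometric summable_geometric suminf_ennreal2)
  finally show ?thesis by (simp add: q_def I_def)
qed

lemma shell_cover_outside: "{z. 1 \<le> norm z} \<subseteq> (\<Union>k. shell (2 ^ k))"
proof
  fix z :: 'a assume "z \<in> {z. 1 \<le> norm z}"
  then have z: "1 \<le> norm z" by simp
  have z0: "0 < norm z" using z by linarith
  define k where "k = nat \<lfloor>log 2 (norm z)\<rfloor>"
  have l: "0 \<le> log 2 (norm z)" using z by (subst zero_le_log_cancel_iff) auto
  have k: "real k \<le> log 2 (norm z)" "log 2 (norm z) < real k + 1"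
    using l unfolding k_def by linarith+
  have "2 powr real k \<le> norm z" "norm z < 2 powr (real k + 1)"
    using k z0 le_log_iff[of 2 "norm z" "real k"] log_less_iff[of 2 "norm z" "real k + 1"]
    by (auto simp del: zero_less_norm_iff)
  then have "z \<in> shell (2 ^ k)" by (simp add: shell_def powr_realpow powr_add)
  then show "z \<in> (\<Union>k. shell (2 ^ k))" by blast
qed

lemma shell_cover_inside: "{z. 0 < norm z \<and> norm z < 1} \<subseteq> (\<Union>k. shell ((1 / 2) ^ k))"
proof
  fix z :: 'a assume "z \<in> {z. 0 < norm z \<and> norm z < 1}"
  then have z: "0 < norm z" "norm z < 1" by auto
  define k where "k = nat \<lceil>- log 2 (norm z)\<rceil>"
  have l: "0 < - log 2 (norm z)" using z by (simp add: log_less_zero_cancel_iff)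
  have k: "- real k \<le> log 2 (norm z)" "log 2 (norm z) < 1 - real k"
    using l unfolding k_def by linarith+
  have "2 powr (- real k) \<le> norm z" "norm z < 2 powr (1 - real k)"
    using k z by (auto simp: le_log_iff log_less_iff)
  then have "z \<in> shell ((1 / 2) ^ k)"
    by (simp add: shell_def powr_realpow powr_diff powr_minus power_one_over inverse_eq_divide)
  then show "z \<in> (\<Union>k. shell ((1 / 2) ^ k))" by blast
qed

lemma integrable_lborel_indicatorI:
  assumes [measurable]: "f \<in> borel_measurable borel" "A \<in> sets borel"
    and "\<And>z. 0 \<le> f z" "(\<integral>\<^sup>+z. ennreal (f z) * indicator A z \<partial>lborel) < \<infinity>"
  shows "integrable lborel (\<lambda>z. indicator A z * f z)"
proof (rule integrableI_nonneg)
  have "(\<integral>\<^sup>+z. ennreal (indicator A z * f z) \<partial>lborel) = (\<integral>\<^sup>+z. ennreal (f z) * indicator A z \<partial>lborel)"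
    by (intro nn_integral_cong) (simp split: split_indicator)
  then show "(\<integral>\<^sup>+z. ennreal (indicator A z * f z) \<partial>lborel) < \<infinity>" using assms by simp
qed (use assms in auto)

lemma nn_integral_shell_finite:
  fixes d :: real
  shows "(\<integral>\<^sup>+z. ennreal (norm z powr d) * indicator (shell 1 :: 'a::euclidean_space set) z \<partial>lborel) < \<infinity>"
proof -
  have "norm z powr d \<le> 2 powr \<bar>d\<bar>" if "z \<in> shell 1" for z :: 'a
  proof -
    have z: "1 \<le> norm z" "norm z < 2" using that by (auto simp: shell_def)
    have "norm z powr d \<le> norm z powr \<bar>d\<bar>" using z by (intro powr_mono) auto
    also have "\<dots> \<le> 2 powr \<bar>d\<bar>" using z by (intro powr_mono2) auto
    finally show ?thesis .
  qed
  then have "(\<integral>\<^sup>+z. ennreal (norm z powr d) * indicator (shell 1 :: 'a set) z \<partial>lborel)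
    \<le> (\<integral>\<^sup>+z. ennreal (2 powr \<bar>d\<bar>) * indicator (shell 1 :: 'a set) z \<partial>lborel)"
    by (intro nn_integral_mono) (auto split: split_indicator)
  also have "\<dots> = ennreal (2 powr \<bar>d\<bar>) * emeasure lborel (shell 1 :: 'a set)"
    by (simp add: nn_integral_cmult_indicator)
  also have "\<dots> < \<infinity>"
  proof -
    have "bounded (shell 1 :: 'a set)"
      by (rule bounded_subset[of "cball 0 2"]) (auto simp: shell_def)
    then show ?thesis using emeasure_bounded_finite by (auto simp: ennreal_mult_less_top)
  qed
  finally show ?thesis .
qed

lemma powr_scale: "0 < c \<Longrightarrow> norm (c *\<^sub>R z) powr d = c powr d * norm z powr d"
  by (simp add: powr_mult)

lemma integrable_norm_powr_outside:
  assumes "real DIM('a::euclidean_space) + d < 0" "0 < r"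
  shows "integrable lborel (\<lambda>z :: 'a. indicator {z. r \<le> norm z} z * norm z powr d)"
proof -
  define f where "f z = ennreal (norm z powr d)" for z :: 'a
  have [measurable]: "f \<in> borel_measurable borel" unfolding f_def by measurable
  have hom: "f (c *\<^sub>R z) = ennreal (c powr d) * f z" if "0 < c" for c z
    using that by (simp add: f_def powr_scale[OF that] ennreal_mult del: norm_scaleR)
  have "(\<integral>\<^sup>+z. f z * indicator {z. r \<le> norm z} z \<partial>lborel) =
     ennreal (r powr (real DIM('a) + d)) * (\<integral>\<^sup>+z. f z * indicator {z. 1 \<le> norm z} z \<partial>lborel)"
    using assms by (intro nn_integral_homogeneous_scale hom) auto
  also have "\<dots> < \<infinity>"
  proof -
    have "(\<integral>\<^sup>+z. f z * indicator {z. 1 \<le> norm z} z \<partial>lborel) \<le>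
       ennreal (1 / (1 - 2 powr (real DIM('a) + d))) * (\<integral>\<^sup>+z. f z * indicator (shell 1) z \<partial>lborel)"
      using assms shell_cover_outside powr_less_mono[of "real DIM('a) + d" 0 2]
      by (intro nn_integral_homogeneous_le hom) auto
    also have "\<dots> < \<infinity>"
      using nn_integral_shell_finite[of d, where 'a='a] by (simp add: f_def ennreal_mult_less_top)
    finally show ?thesis by (simp add: ennreal_mult_less_top)
  qed
  finally show ?thesis
    by (intro integrable_lborel_indicatorI) (simp_all add: f_def)
qed

lemma integrable_norm_powr_inside:
  assumes "0 < real DIM('a::euclidean_space) + d"
  shows "integrable lborel (\<lambda>z :: 'a. indicator {z. norm z < 1} z * norm z powr d)"
proof -
  define f where "f z = ennreal (norm z powr d)" for z :: 'a
  have [measurable]: "f \<in> borel_measurable borel" unfolding f_def by measurable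
  have hom: "f (c *\<^sub>R z) = ennreal (c powr d) * f z" if "0 < c" for c z
    using that by (simp add: f_def powr_scale[OF that] ennreal_mult del: norm_scaleR)
  \<comment> \<open>The shells miss the origin, which may be dropped because
    \<open>0 powr d = 0\<close>.\<close>
  have "(\<integral>\<^sup>+z. f z * indicator {z. norm z < 1} z \<partial>lborel) =
      (\<integral>\<^sup>+z. f z * indicator {z. 0 < norm z \<and> norm z < 1} z \<partial>lborel)"
    by (intro nn_integral_cong) (auto simp: f_def split: split_indicator)
  also have "\<dots> \<le>
       ennreal (1 / (1 - (1/2) powr (real DIM('a) + d))) * (\<integral>\<^sup>+z. f z * indicator (shell 1) z \<partial>lborel)"
    using assms shell_cover_inside
    by (intro nn_integral_homogeneous_le hom) (auto simp: powr01_less_one)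
  also have "\<dots> < \<infinity>"
    using nn_integral_shell_finite[of d, where 'a='a] by (simp add: f_def ennreal_mult_less_top)
  finally show ?thesis
    by (intro integrable_lborel_indicatorI) (simp_all add: f_def)
qed

section \<open>Kernels singular along a hyperplane\<close>

text \<open>What matters is that the bound does not depend on \<open>c\<close>. Where |c + t| > 1
  the integrand is at most 1; elsewhere, according to the sign of c + t, a translation or a
  reflection carries it to t^\<beta> on the unit interval, whose integral is 1 / (\<beta> +
  1).\<close>

lemma nn_integral_abs_powr_shift_le:
  assumes "-1 < \<beta>" "\<beta> \<le> (0::real)"
  shows "(\<integral>\<^sup>+t. ennreal (\<bar>c + t\<bar> powr \<beta>) * indicator {0..1} t \<partial>lborel) \<le> ennreal (1 + 2 / (\<beta> + 1))"
proof -
  let ?g = "\<lambda>t::real. ennreal (t powr \<beta>) * indicator {0..1} t"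
  have "(\<integral>\<^sup>+t. ennreal (t powr \<beta> * indicator {0..1} t) \<partial>lborel) = ennreal (1 / (\<beta> + 1))"
  proof (rule nn_integral_has_integral_lborel)
    show "((\<lambda>t. t powr \<beta> * indicator {0..1} t) has_integral 1 / (\<beta> + 1)) UNIV"
    proof -
      have "((\<lambda>t. if t \<in> {0..1} then t powr \<beta> else 0) has_integral 1 / (\<beta> + 1)) UNIV"
        using has_integral_powr_from_0[of \<beta> 1] assms by (subst has_integral_restrict_UNIV) auto
      then show ?thesis
        by (rule has_integral_eq[rotated]) auto
    qed
  qed auto
  then have g: "(\<integral>\<^sup>+t. ?g t \<partial>lborel) = ennreal (1 / (\<beta> + 1))"
    by (simp add: ennreal_mult' ennreal_indicator)
  have pw: "ennreal (\<bar>c + t\<bar> powr \<beta>) * indicator {0..1} t \<le>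
      indicator {0..1} t + (?g (c + 1 * t) + ?g (- c + (-1) * t))" for t
  proof (cases "\<bar>c + t\<bar> \<le> 1")
    case True
    have "ennreal (\<bar>c + t\<bar> powr \<beta>) \<le> ?g (c + 1 * t) + ?g (- c + (-1) * t)"
      using True by (cases "0 \<le> c + t") (auto simp: indicator_def abs_if)
    then show ?thesis by (cases "t \<in> {0..1}") (auto intro: add_increasing)
  next
    case False
    then have "\<bar>c + t\<bar> powr \<beta> \<le> 1"
      using assms powr_mono2'[of \<beta> 1 "\<bar>c + t\<bar>"] by simp
    then have "ennreal (\<bar>c + t\<bar> powr \<beta>) * indicator {0..1} t \<le> indicator {0..1} t"
      by (simp split: split_indicator)
    then show ?thesis by (rule add_increasing2[rotated]) simp
  qed
  have "(\<integral>\<^sup>+t. ennreal (\<bar>c + t\<bar> powr \<beta>) * indicator {0..1} t \<partial>lborel) \<le>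
     (\<integral>\<^sup>+t. indicator {0..1} t + (?g (c + 1 * t) + ?g (- c + (-1) * t)) \<partial>lborel)"
    by (intro nn_integral_mono pw)
  also have "\<dots> = (\<integral>\<^sup>+t. indicator {0..1::real} t \<partial>lborel) +
      ((\<integral>\<^sup>+t. ?g (c + 1 * t) \<partial>lborel) + (\<integral>\<^sup>+t. ?g (- c + (-1) * t) \<partial>lborel))"
    by (subst nn_integral_add, simp, simp, subst nn_integral_add) auto
  also have "(\<integral>\<^sup>+t. ?g (c + 1 * t) \<partial>lborel) = ennreal (1 / (\<beta> + 1))"
    using nn_integral_real_affine[of ?g 1 c] g by simp
  also have "(\<integral>\<^sup>+t. ?g (- c + (-1) * t) \<partial>lborel) = ennreal (1 / (\<beta> + 1))"
    using nn_integral_real_affine[of ?g "-1" "-c"] g by simp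
  also have "(\<integral>\<^sup>+t. indicator {0..1::real} t \<partial>lborel) = ennreal 1" by simp
  also have "ennreal 1 + (ennreal (1 / (\<beta> + 1)) + ennreal (1 / (\<beta> + 1))) = ennreal (1 + 2 / (\<beta> + 1))"
    using assms by (simp del: ennreal_1 flip: ennreal_plus)
  finally show ?thesis .
qed

text \<open>Averaging over the translates \<open>z + t u\<close>, where \<open>\<xi> \<bullet> u = 1\<close>, reduces the bound to the
  one-dimensional one, with a constant that depends on \<open>\<xi>\<close> only through a lower bound on its norm.\<close>

lemma nn_integral_inner_powr_le:
  fixes \<xi> :: "'a::euclidean_space"
  assumes \<beta>: "-1 < \<beta>" "\<beta> \<le> (0::real)" and \<kappa>: "0 < \<kappa>" "\<kappa> \<le> norm \<xi>"
  shows "(\<integral>\<^sup>+z. ennreal (\<bar>\<xi> \<bullet> z\<bar> powr \<beta>) * indicator {z. norm z < 2} z \<partial>lborel)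
    \<le> ennreal (1 + 2 / (\<beta> + 1)) * emeasure lborel (ball (0::'a) (2 + 1 / \<kappa>))"
proof -
  \<comment> \<open>This is the shortest vector with \<open>\<xi> \<bullet> u = 1\<close>; its norm
    is at most \<open>1 / \<kappa>\<close>, so all the translates of the ball of radius 2 stay
    inside \<open>ball 0 (2 + 1 / \<kappa>)\<close>, whatever \<open>\<xi>\<close> is.\<close>
  define u where "u = (1 / (\<xi> \<bullet> \<xi>)) *\<^sub>R \<xi>"
  have \<xi>0: "\<xi> \<noteq> 0" using \<kappa> by auto
  have \<xi>u: "\<xi> \<bullet> u = 1" using \<xi>0 by (simp add: u_def)
  have "norm u = 1 / norm \<xi>" using \<xi>0 by (simp add: u_def power2_norm_eq_inner[symmetric] power2_eq_square)
  then have nu: "norm u \<le> 1 / \<kappa>" using \<kappa> by (simp add: frac_le)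
  let ?h = "\<lambda>z. ennreal (\<bar>\<xi> \<bullet> z\<bar> powr \<beta>) * indicator {z. norm z < 2} z"
  let ?I = "\<integral>\<^sup>+z. ?h z \<partial>lborel"
  let ?B = "ball (0::'a) (2 + 1 / \<kappa>)"
  have le: "?I \<le> (\<integral>\<^sup>+z. ennreal (\<bar>\<xi> \<bullet> z + t\<bar> powr \<beta>) * indicator ?B z \<partial>lborel)" if t: "t \<in> {0..1}" for t
  proof -
    have h: "?h \<in> borel_measurable borel" by measurable
    have "?I = (\<integral>\<^sup>+z. ?h (t *\<^sub>R u + 1 *\<^sub>R z) \<partial>lborel)"
      using nn_integral_lborel_affine[OF h, of 1 "t *\<^sub>R u"] by simp
    also have "\<dots> \<le> (\<integral>\<^sup>+z. ennreal (\<bar>\<xi> \<bullet> z + t\<bar> powr \<beta>) * indicator ?B z \<partial>lborel)"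
    proof (intro nn_integral_mono)
      fix z
      have "z \<in> ?B" if "norm (t *\<^sub>R u + z) < 2"
      proof -
        have "norm z \<le> norm (t *\<^sub>R u + z) + norm (t *\<^sub>R u)"
          using norm_triangle_ineq4[of "t *\<^sub>R u + z" "t *\<^sub>R u"] by simp
        also have "norm (t *\<^sub>R u) \<le> 1 * (1 / \<kappa>)" using t nu by (simp only: norm_scaleR) (intro mult_mono, auto)
        finally show ?thesis using that by simp
      qed
      then show "?h (t *\<^sub>R u + 1 *\<^sub>R z) \<le> ennreal (\<bar>\<xi> \<bullet> z + t\<bar> powr \<beta>) * indicator ?B z"
        by (auto simp: inner_add_right \<xi>u add.commute split: split_indicator)
    qed
    finally show ?thesis .
  qed
  have "?I = (\<integral>\<^sup>+t. ?I * indicator {0..1::real} t \<partial>lborel)"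
    by (subst nn_integral_cmult_indicator) auto
  also have "\<dots> \<le> (\<integral>\<^sup>+t. (\<integral>\<^sup>+z. ennreal (\<bar>\<xi> \<bullet> z + t\<bar> powr \<beta>) * indicator ?B z * indicator {0..1} t \<partial>lborel) \<partial>lborel)"
    using le by (intro nn_integral_mono) (auto split: split_indicator)
  also have "\<dots> = (\<integral>\<^sup>+z. (\<integral>\<^sup>+t. ennreal (\<bar>\<xi> \<bullet> z + t\<bar> powr \<beta>) * indicator ?B z * indicator {0..1} t \<partial>lborel) \<partial>lborel)"
  proof (rule lborel_pair.Fubini')
    have [measurable]: "?B \<in> sets borel" "{0..1::real} \<in> sets borel" by auto
    show "(\<lambda>(z, t). ennreal (\<bar>\<xi> \<bullet> z + t\<bar> powr \<beta>) * indicator ?B z * indicator {0..1} t)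
        \<in> borel_measurable (lborel \<Otimes>\<^sub>M lborel)"
      by (simp add: split_beta) measurable
  qed
  also have "\<dots> = (\<integral>\<^sup>+z. (\<integral>\<^sup>+t. ennreal (\<bar>\<xi> \<bullet> z + t\<bar> powr \<beta>) * indicator {0..1} t \<partial>lborel) * indicator ?B z \<partial>lborel)"
    by (intro nn_integral_cong, subst nn_integral_multc[symmetric]) (auto simp: mult_ac)
  also have "\<dots> \<le> (\<integral>\<^sup>+z. ennreal (1 + 2 / (\<beta> + 1)) * indicator ?B z \<partial>lborel)"
    by (intro nn_integral_mono mult_right_mono nn_integral_abs_powr_shift_le \<beta>) auto
  also have "\<dots> = ennreal (1 + 2 / (\<beta> + 1)) * emeasure lborel ?B"
    by (subst nn_integral_cmult_indicator) auto
  finally show ?thesis .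
qed

text \<open>The integrand is homogeneous of degree p - n - \<sigma>, n being the dimension, so
  scaling produces the power of \<open>r\<close>, and \<sigma> < p makes the series over the shells
  converge at the origin. On one shell the norm is comparable to 1 and only the hyperplane
  singularity remains, of order p - 2 > -1. The constant must be uniform in \<open>\<xi>\<close>
  because the slope of a paraboloid varies with the point at which it is taken.\<close>

lemma singular_kernel_bound:
  fixes p \<sigma> \<kappa> :: real
  assumes p: "1 < p" "p < 2" and \<sigma>: "\<sigma> < p" and \<kappa>: "0 < \<kappa>"
  obtains C where "0 \<le> C" and "\<And>(\<xi>::'a::euclidean_space) r. \<kappa> \<le> norm \<xi> \<Longrightarrow> 0 < r \<Longrightarrow>
      (\<integral>\<^sup>+z. ennreal (\<bar>\<xi> \<bullet> z\<bar> powr (p - 2) * norm z powr (2 - real DIM('a) - \<sigma>)) * indicator {z. norm z < r} z \<partial>lborel)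
      \<le> ennreal (C * r powr (p - \<sigma>))"
proof -
  define e where "e = 2 - real DIM('a) - \<sigma>"
  define d where "d = p - real DIM('a) - \<sigma>"
  define D where "D = 2 powr \<bar>e\<bar> * ((1 + 2 / (p - 1)) * measure lborel (ball (0::'a) (2 + 1 / \<kappa>)))"
  define Q where "Q = 1 / (1 - (1/2) powr (p - \<sigma>))"
  have Q: "0 \<le> Q" using \<sigma> by (auto simp: Q_def powr_le1)
  have D: "0 \<le> D" using p by (auto simp: D_def)
  have "(\<integral>\<^sup>+z. ennreal (\<bar>\<xi> \<bullet> z\<bar> powr (p - 2) * norm z powr e) * indicator {z. norm z < r} z \<partial>lborel)
      \<le> ennreal ((Q * D) * r powr (p - \<sigma>))" if \<xi>: "\<kappa> \<le> norm \<xi>" and r: "0 < r" for \<xi> :: 'a and r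
  proof -
    define f where "f z = ennreal (\<bar>\<xi> \<bullet> z\<bar> powr (p - 2) * norm z powr e)" for z
    have [measurable]: "f \<in> borel_measurable borel" unfolding f_def by measurable
    have hom: "f (c *\<^sub>R z) = ennreal (c powr d) * f z" if "0 < c" for c z
    proof -
      have "c powr d = c powr (p - 2) * c powr e" by (simp add: d_def e_def powr_add[symmetric] algebra_simps)
      then show ?thesis using that
        by (simp add: f_def ennreal_mult[symmetric] abs_mult powr_mult mult_ac)
    qed
    have "(\<integral>\<^sup>+z. f z * indicator (shell 1) z \<partial>lborel) \<le>
        (\<integral>\<^sup>+z. ennreal (2 powr \<bar>e\<bar>) * (ennreal (\<bar>\<xi> \<bullet> z\<bar> powr (p - 2)) * indicator {z. norm z < 2} z) \<partial>lborel)"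
    proof (intro nn_integral_mono)
      fix z :: 'a
      show "f z * indicator (shell 1) z \<le>
        ennreal (2 powr \<bar>e\<bar>) * (ennreal (\<bar>\<xi> \<bullet> z\<bar> powr (p - 2)) * indicator {z. norm z < 2} z)"
      proof (cases "z \<in> shell 1")
        case True
        then have z: "1 \<le> norm z" "norm z < 2" by (auto simp: shell_def)
        have "norm z powr e \<le> norm z powr \<bar>e\<bar>" using z by (intro powr_mono) auto
        also have "\<dots> \<le> 2 powr \<bar>e\<bar>" using z by (intro powr_mono2) auto
        finally have "\<bar>\<xi> \<bullet> z\<bar> powr (p - 2) * norm z powr e \<le> \<bar>\<xi> \<bullet> z\<bar> powr (p - 2) * 2 powr \<bar>e\<bar>"
          by (intro mult_left_mono) auto
        then show ?thesis using z True
          by (simp add: f_def ennreal_mult[symmetric] mult.commute ennreal_leI)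
      qed simp
    qed
    also have "\<dots> = ennreal (2 powr \<bar>e\<bar>) * (\<integral>\<^sup>+z. ennreal (\<bar>\<xi> \<bullet> z\<bar> powr (p - 2)) * indicator {z. norm z < 2} z \<partial>lborel)"
      by (rule nn_integral_cmult) measurable
    also have "\<dots> \<le> ennreal (2 powr \<bar>e\<bar>) * (ennreal (1 + 2 / (p - 1)) * emeasure lborel (ball (0::'a) (2 + 1 / \<kappa>)))"
      using nn_integral_inner_powr_le[of "p - 2" \<kappa> \<xi>] p \<kappa> \<xi> by (intro mult_left_mono) auto
    also have "\<dots> = ennreal D"
      using p emeasure_bounded_finite[of "ball (0::'a) (2 + 1 / \<kappa>)"]
      by (simp add: D_def ennreal_mult emeasure_eq_ennreal_measure less_top)
    finally have I: "(\<integral>\<^sup>+z. f z * indicator (shell 1) z \<partial>lborel) \<le> ennreal D" .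
    have dd: "real DIM('a) + d = p - \<sigma>" by (simp add: d_def)
    have "(\<integral>\<^sup>+z. f z * indicator {z. norm z < r} z \<partial>lborel) =
       ennreal (r powr (real DIM('a) + d)) * (\<integral>\<^sup>+z. f z * indicator {z. norm z < 1} z \<partial>lborel)"
      using r by (intro nn_integral_homogeneous_scale hom) auto
    also have "(\<integral>\<^sup>+z. f z * indicator {z. norm z < 1} z \<partial>lborel) =
        (\<integral>\<^sup>+z. f z * indicator {z. 0 < norm z \<and> norm z < 1} z \<partial>lborel)"
      by (intro nn_integral_cong) (auto simp: f_def split: split_indicator)
    also have "\<dots> \<le> ennreal (1 / (1 - (1/2) powr (real DIM('a) + d))) * (\<integral>\<^sup>+z. f z * indicator (shell 1) z \<partial>lborel)"
      using shell_cover_inside \<sigma> dd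
      by (intro nn_integral_homogeneous_le hom) (auto simp: powr01_less_one)
    also have "\<dots> \<le> ennreal Q * ennreal D"
      unfolding dd Q_def by (intro mult_left_mono I) auto
    also have "ennreal (r powr (real DIM('a) + d)) * (ennreal Q * ennreal D) = ennreal ((Q * D) * r powr (p - \<sigma>))"
      unfolding dd using Q D by (simp add: ennreal_mult[symmetric] mult_ac)
    finally show ?thesis by (simp add: f_def mult_left_mono)
  qed
  then show thesis using that[of "Q * D"] Q D by (simp add: e_def)
qed

subsection \<open>Mollification\<close>

text \<open>The powers of t in the denominator make the family closed under differentiation up to
  linear combinations.\<close>

definition flat_exp :: "nat \<Rightarrow> real \<Rightarrow> real" where
  "flat_exp m t = (if t \<le> 0 then 0 else exp (- (1 / t)) / t ^ m)"

text \<open>Makes the difference quotient at 0 tend to 0. The constant comes from x <= exp x at x =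
  1 / (n t) with n = m + 2: its n-th power gives (n t)^(-n) <= exp(1 / t), and two powers of t are
  left after division by t^m.\<close>

lemma flat_exp_le_square: "\<bar>flat_exp m t\<bar> \<le> real (m + 2) ^ (m + 2) * t\<^sup>2"
proof (cases "t \<le> 0")
  case False
  define n where "n = m + 2"
  have n: "0 < real n" by (simp add: n_def)
  have "(1 / (real n * t)) ^ n \<le> exp (1 / (real n * t)) ^ n"
    using False n exp_ge_add_one_self[of "1 / (real n * t)"] by (intro power_mono) (linarith, simp)
  also have "\<dots> = exp (1 / t)" using n by (simp add: exp_of_nat_mult[symmetric])
  finally have "1 \<le> exp (1 / t) * (real n * t) ^ n"
    using False n by (simp add: power_one_over field_simps)
  then have "exp (- (1 / t)) \<le> real n ^ n * t ^ n"
    by (simp add: exp_minus power_mult_distrib field_simps)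
  then have "exp (- (1 / t)) / t ^ m \<le> real n ^ n * t ^ n / t ^ m"
    using False by (intro divide_right_mono) auto
  also have "\<dots> = real n ^ n * t\<^sup>2" using False by (simp add: n_def power2_eq_square)
  finally show ?thesis using False by (simp add: flat_exp_def n_def)
qed (simp add: flat_exp_def)

lemma has_derivative_flat_exp:
  "(flat_exp m has_real_derivative flat_exp (m + 2) t - real m * flat_exp (m + 1) t) (at t)"
proof -
  consider "t < 0" | "t = 0" | "0 < t" by linarith
  then show ?thesis
  proof cases
    case 1
    have "((\<lambda>_. 0) has_real_derivative flat_exp (m + 2) t - real m * flat_exp (m + 1) t) (at t)"
      using 1 by (simp add: flat_exp_def)
    then show ?thesis
      by (rule has_field_derivative_transform_within_open[of _ _ _ "{..<0}"]) (use 1 in \<open>auto simp: flat_exp_def\<close>)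
  next
    case 2
    define C where "C = real (m + 2) ^ (m + 2)"
    have "((\<lambda>h. flat_exp m h / h) \<longlongrightarrow> 0) (at 0)"
    proof (rule Lim_null_comparison)
      show "\<forall>\<^sub>F h in at 0. norm (flat_exp m h / h) \<le> C * \<bar>h\<bar>"
      proof (rule eventually_at_filter[THEN iffD2, OF always_eventually], intro allI impI)
        fix h :: real assume "h \<noteq> 0"
        then show "norm (flat_exp m h / h) \<le> C * \<bar>h\<bar>"
          using flat_exp_le_square[of m h]
          by (simp add: C_def abs_divide divide_le_eq power2_eq_square mult.assoc abs_mult_self_eq)
      qed
      show "((\<lambda>h. C * \<bar>h\<bar>) \<longlongrightarrow> 0) (at 0)" by (auto intro!: tendsto_eq_intros)
    qed
    then show ?thesis using 2 by (simp add: DERIV_def flat_exp_def)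
  next
    case 3
    have "((\<lambda>t. exp (- (1 / t)) / t ^ m) has_real_derivative flat_exp (m + 2) t - real m * flat_exp (m + 1) t) (at t)"
    proof (cases m)
      case 0
      then show ?thesis using 3
        by (auto intro!: derivative_eq_intros simp: flat_exp_def power2_eq_square)
    next
      case (Suc k)
      then show ?thesis using 3
        by (auto intro!: derivative_eq_intros simp: flat_exp_def field_simps power2_eq_square)
          (cases k; simp)
    qed
    then show ?thesis
      by (rule has_field_derivative_transform_within_open[of _ _ _ "{0<..}"]) (use 3 in \<open>auto simp: flat_exp_def\<close>)
  qed
qed

text \<open>A class of functions supported in the ball of radius \<open>\<rho>\<close> that is closed under partial
  derivatives, so that all its members are smooth.\<close>

inductive bump_class :: "real \<Rightarrow> ('a::euclidean_space \<Rightarrow> real) \<Rightarrow> bool" for \<rho> where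
  base: "bump_class \<rho> (\<lambda>x. flat_exp m (\<rho>\<^sup>2 - x \<bullet> x))"
| add: "bump_class \<rho> f \<Longrightarrow> bump_class \<rho> g \<Longrightarrow> bump_class \<rho> (\<lambda>x. f x + g x)"
| scale: "bump_class \<rho> f \<Longrightarrow> bump_class \<rho> (\<lambda>x. c * f x)"
| coord: "bump_class \<rho> f \<Longrightarrow> bump_class \<rho> (\<lambda>x. (x \<bullet> e) * f x)"

text \<open>The chain rule brings out a factor x from the inner function \<rho>^2 - |x|^2 and the
  product rule adds sums; the closure rules of the class are exactly what these require. A gradient
  vector, paired with arbitrary \<open>e\<close>, keeps the induction free of coordinates.\<close>

lemma bump_class_gradient:
  assumes "bump_class \<rho> f"
  shows "\<exists>G. (\<forall>x. (f has_derivative (\<lambda>h. G x \<bullet> h)) (at x)) \<and> (\<forall>e. bump_class \<rho> (\<lambda>x. G x \<bullet> e))"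
  using assms
proof induction
  case (base m)
  let ?d = "\<lambda>x. flat_exp (m + 2) (\<rho>\<^sup>2 - x \<bullet> x) - real m * flat_exp (m + 1) (\<rho>\<^sup>2 - x \<bullet> x)"
  let ?G = "\<lambda>x::'a. (- 2 * ?d x) *\<^sub>R x"
  have "((\<lambda>x. flat_exp m (\<rho>\<^sup>2 - x \<bullet> x)) has_derivative (\<lambda>h. ?G x \<bullet> h)) (at x)" for x
  proof -
    have "((\<lambda>x. \<rho>\<^sup>2 - x \<bullet> x) has_derivative (\<lambda>h. - 2 * (x \<bullet> h))) (at x)"
      by (auto intro!: derivative_eq_intros simp: inner_commute)
    from has_derivative_compose[OF this has_derivative_flat_exp[unfolded has_field_derivative_def]]
    show ?thesis by (rule has_derivative_eq_rhs) (simp add: fun_eq_iff algebra_simps)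
  qed
  moreover have "bump_class \<rho> (\<lambda>x. ?G x \<bullet> e)" for e
  proof -
    have "bump_class \<rho> (\<lambda>x. (x \<bullet> e) * ((- 2) * flat_exp (m + 2) (\<rho>\<^sup>2 - x \<bullet> x) + (2 * real m) * flat_exp (m + 1) (\<rho>\<^sup>2 - x \<bullet> x)))"
      by (intro bump_class.intros)
    also have "(\<lambda>x. (x \<bullet> e) * ((- 2) * flat_exp (m + 2) (\<rho>\<^sup>2 - x \<bullet> x) + (2 * real m) * flat_exp (m + 1) (\<rho>\<^sup>2 - x \<bullet> x))) = (\<lambda>x. ?G x \<bullet> e)"
      by (simp add: fun_eq_iff algebra_simps)
    finally show ?thesis .
  qed
  ultimately show ?case by (intro exI[of _ ?G]) blast
next
  case (add f g)
  then obtain F G where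
    F: "\<And>x. (f has_derivative (\<lambda>h. F x \<bullet> h)) (at x)" "\<And>e. bump_class \<rho> (\<lambda>x. F x \<bullet> e)" and
    G: "\<And>x. (g has_derivative (\<lambda>h. G x \<bullet> h)) (at x)" "\<And>e. bump_class \<rho> (\<lambda>x. G x \<bullet> e)"
    by metis
  show ?case
  proof (intro exI[of _ "\<lambda>x. F x + G x"] conjI allI)
    show "((\<lambda>x. f x + g x) has_derivative (\<lambda>h. (F x + G x) \<bullet> h)) (at x)" for x
      using has_derivative_add[OF F(1) G(1)] by (simp add: inner_add_left)
    show "bump_class \<rho> (\<lambda>x. (F x + G x) \<bullet> e)" for e
      using bump_class.add[OF F(2) G(2)] by (simp add: inner_add_left)
  qed
next
  case (scale f c)
  then obtain F where
    F: "\<And>x. (f has_derivative (\<lambda>h. F x \<bullet> h)) (at x)" "\<And>e. bump_class \<rho> (\<lambda>x. F x \<bullet> e)"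
    by metis
  show ?case
  proof (intro exI[of _ "\<lambda>x. c *\<^sub>R F x"] conjI allI)
    show "((\<lambda>x. c * f x) has_derivative (\<lambda>h. (c *\<^sub>R F x) \<bullet> h)) (at x)" for x
      using has_derivative_mult_right[OF F(1)] by simp
    show "bump_class \<rho> (\<lambda>x. (c *\<^sub>R F x) \<bullet> e)" for e
      using bump_class.scale[OF F(2)] by simp
  qed
next
  case (coord f b)
  then obtain F where
    F: "\<And>x. (f has_derivative (\<lambda>h. F x \<bullet> h)) (at x)" "\<And>e. bump_class \<rho> (\<lambda>x. F x \<bullet> e)"
    by metis
  show ?case
  proof (intro exI[of _ "\<lambda>x. (x \<bullet> b) *\<^sub>R F x + f x *\<^sub>R b"] conjI allI)
    show "((\<lambda>x. (x \<bullet> b) * f x) has_derivative (\<lambda>h. ((x \<bullet> b) *\<^sub>R F x + f x *\<^sub>R b) \<bullet> h)) (at x)" for x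
      by (rule has_derivative_eq_rhs, rule has_derivative_mult, rule has_derivative_inner_left,
          rule has_derivative_ident, rule F(1))
         (simp add: fun_eq_iff inner_add_left inner_add_right inner_commute)
    have "bump_class \<rho> (\<lambda>x. (x \<bullet> b) * (F x \<bullet> e) + (b \<bullet> e) * f x)" for e
      by (intro bump_class.intros F(2) coord)
    then show "bump_class \<rho> (\<lambda>x. ((x \<bullet> b) *\<^sub>R F x + f x *\<^sub>R b) \<bullet> e)" for e
      by (simp add: inner_add_left mult.commute)
  qed
qed

lemma bump_class_continuous: "bump_class \<rho> f \<Longrightarrow> continuous_on A f"
  using bump_class_gradient
  by (metis continuous_at_imp_continuous_on has_derivative_continuous)

text \<open>Any set closed under partial derivatives is an invariant for the recursion of
  \<open>C_k\<close>, so smoothness needs no formula for higher derivatives.\<close>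

lemma C_k_coinduct:
  fixes f :: "'a::euclidean_space \<Rightarrow> real"
  assumes step: "\<And>f. f \<in> S \<Longrightarrow>
      \<exists>f'. (\<forall>x. (f has_derivative f' x) (at x)) \<and> (\<forall>e\<in>Basis. (\<lambda>x. f' x e) \<in> S)"
    and "f \<in> S"
  shows "C_k k f"
  using \<open>f \<in> S\<close>
proof (induction k arbitrary: f)
  case 0
  then show ?case using step
    by (metis C_k.simps(1) continuous_at_imp_continuous_on has_derivative_continuous)
next
  case (Suc k)
  obtain f' where f': "\<And>x. (f has_derivative f' x) (at x)" "\<And>e. e \<in> Basis \<Longrightarrow> (\<lambda>x. f' x e) \<in> S"
    using step[OF Suc.prems] by blast
  have "frechet_derivative f (at x) = f' x" for x
    using frechet_derivative_at[OF f'(1)] by simp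
  then show ?case using f' Suc.IH by (auto simp: differentiable_def)
qed

text \<open>The convolution integral is taken over a box because \<open>leibniz_rule\<close> requires one.\<close>

lemma C_k_convolution:
  assumes f: "bump_class \<rho> f" and \<theta>: "continuous_on UNIV \<theta>"
  shows "C_k k (\<lambda>x. integral (cbox a b) (\<lambda>y. \<theta> y * f (x - y)))"
proof (rule C_k_coinduct[where S = "{\<lambda>x. integral (cbox a b) (\<lambda>y. \<theta> y * g (x - y)) | g. bump_class \<rho> g}"])
  show "(\<lambda>x. integral (cbox a b) (\<lambda>y. \<theta> y * f (x - y))) \<in>
      {\<lambda>x. integral (cbox a b) (\<lambda>y. \<theta> y * g (x - y)) | g. bump_class \<rho> g}"
    using f by blast
next
  fix u assume "u \<in> {\<lambda>x. integral (cbox a b) (\<lambda>y. \<theta> y * g (x - y)) | g. bump_class \<rho> g}"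
  then obtain g where u: "u = (\<lambda>x. integral (cbox a b) (\<lambda>y. \<theta> y * g (x - y)))" and g: "bump_class \<rho> g"
    by blast
  obtain G where G: "\<And>x. (g has_derivative (\<lambda>h. G x \<bullet> h)) (at x)" "\<And>e. bump_class \<rho> (\<lambda>x. G x \<bullet> e)"
    using bump_class_gradient[OF g] by blast
  have contG: "continuous_on UNIV G"
    by (subst continuous_on_componentwise) (use G(2) bump_class_continuous in blast)
  have contg: "continuous_on UNIV g" by (rule bump_class_continuous[OF g])
  \<comment> \<open>The derivative is integrated as a bounded linear map. Evaluation at
    \<open>e\<close> commutes with the integral and returns a convolution with
    \<open>\<lambda>x. G x \<bullet> e\<close>, which is again a bump.\<close>
  let ?L = "\<lambda>x t. blinfun_inner_right (\<theta> t *\<^sub>R G (x - t))"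
  have contL: "continuous_on (UNIV \<times> cbox a b) (\<lambda>(x, t). ?L x t)"
    unfolding split_beta
    by (intro continuous_intros continuous_on_compose2[OF contG] continuous_on_compose2[OF \<theta>]) auto
  have L1: "continuous_on (cbox a b) (?L x)" for x
    by (intro continuous_intros continuous_on_compose2[OF contG] continuous_on_compose2[OF \<theta>]) auto
  have der: "(u has_derivative blinfun_apply (integral (cbox a b) (?L x))) (at x)" for x
    unfolding u
  proof (rule leibniz_rule)
    fix x t assume "t \<in> cbox a b"
    have "((\<lambda>x. g (x - t)) has_derivative (\<lambda>h. G (x - t) \<bullet> h)) (at x)"
    proof -
      have "((\<lambda>x. x - t) has_derivative (\<lambda>h. h)) (at x)"
        by (auto intro!: derivative_eq_intros)
      from has_derivative_compose[OF this G(1)] show ?thesis .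
    qed
    from has_derivative_mult_right[OF this, of "\<theta> t"]
    show "((\<lambda>x. \<theta> t * g (x - t)) has_derivative blinfun_apply (?L x t)) (at x)"
      by (rule has_derivative_eq_rhs) (simp add: fun_eq_iff)
  next
    show "(\<lambda>y. \<theta> y * g (x - y)) integrable_on cbox a b" for x
      by (intro integrable_continuous continuous_intros continuous_on_compose2[OF contg]
          continuous_on_compose2[OF \<theta>]) auto
  qed (use contL in auto)
  have app: "blinfun_apply (integral (cbox a b) (?L x)) e = integral (cbox a b) (\<lambda>y. \<theta> y * (G (x - y) \<bullet> e))" for x e
  proof -
    have "integral (cbox a b) ((\<lambda>F. blinfun_apply F e) \<circ> ?L x) = blinfun_apply (integral (cbox a b) (?L x)) e"
      by (intro integral_linear integrable_continuous L1) (rule blinfun.bounded_linear_left)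
    then show ?thesis by (simp add: o_def)
  qed
  show "\<exists>u'. (\<forall>x. (u has_derivative u' x) (at x)) \<and>
      (\<forall>e\<in>Basis. (\<lambda>x. u' x e) \<in> {\<lambda>x. integral (cbox a b) (\<lambda>y. \<theta> y * g (x - y)) | g. bump_class \<rho> g})"
    using der G(2) unfolding app[symmetric]
    by (intro exI[of _ "\<lambda>x. blinfun_apply (integral (cbox a b) (?L x))"]) (auto simp: app)
qed

section \<open>Smooth approximation of Lipschitz functions with bounded support\<close>

lemma integrable_continuous_compact_support:
  fixes f :: "'a::euclidean_space \<Rightarrow> real"
  assumes "continuous_on UNIV f" "\<And>x. R < norm x \<Longrightarrow> f x = 0"
  shows "integrable lborel f"
proof -
  have "integrable lborel (\<lambda>x. indicator (cball 0 R) x *\<^sub>R f x)"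
    using assms(1) by (intro borel_integrable_compact) (auto intro: continuous_on_subset)
  also have "(\<lambda>x. indicator (cball 0 R) x *\<^sub>R f x) = f"
    using assms(2) by (auto simp: indicator_def fun_eq_iff not_le)
  finally show ?thesis .
qed

lemma AE_zero_open_imp_zero:
  fixes f :: "'a::euclidean_space \<Rightarrow> real"
  assumes S: "open S" "continuous_on S f" and AE: "AE x in lborel. x \<in> S \<longrightarrow> f x = 0"
    and x: "x \<in> S"
  shows "f x = 0"
proof (rule ccontr)
  assume "f x \<noteq> 0"
  have op: "open (S \<inter> f -` (- {0}))"
    using S by (intro continuous_open_preimage) auto
  have "AE x in lebesgue. x \<notin> S \<inter> f -` (- {0})"
    using AE by (intro AE_completion) (auto elim: eventually_mono)
  then have "negligible (S \<inter> f -` (- {0}))"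
    using op by (auto simp: negligible_iff_null_sets AE_iff_null_sets borel_open)
  then show False using open_not_negligible[OF op] x \<open>f x \<noteq> 0\<close> by auto
qed

lemma integral_eq_0_continuous_imp_zero:
  fixes f :: "'a::euclidean_space \<Rightarrow> real"
  assumes "continuous_on UNIV f" "integrable lborel f" "\<And>x. 0 \<le> f x" "(\<integral>x. f x \<partial>lborel) = 0"
  shows "f x = 0"
  using AE_zero_open_imp_zero[of UNIV f x] assms integral_nonneg_eq_0_iff_AE[of lborel f] by auto

lemma bump_exists:
  assumes "0 < \<rho>"
  obtains \<eta> :: "'a::euclidean_space \<Rightarrow> real" where "bump_class \<rho> \<eta>" "\<And>x. 0 \<le> \<eta> x"
    "\<And>x. \<rho> < norm x \<Longrightarrow> \<eta> x = 0" "integrable lborel \<eta>" "(\<integral>x. \<eta> x \<partial>lborel) = 1"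
proof -
  define \<omega> :: "'a \<Rightarrow> real" where "\<omega> x = flat_exp 0 (\<rho>\<^sup>2 - x \<bullet> x)" for x
  have b: "bump_class \<rho> \<omega>" unfolding \<omega>_def[abs_def] by (rule bump_class.base)
  have nn: "0 \<le> \<omega> x" for x by (simp add: \<omega>_def flat_exp_def)
  have out: "\<omega> x = 0" if "\<rho> < norm x" for x
  proof -
    have "\<rho>\<^sup>2 \<le> (norm x)\<^sup>2" using that assms by (intro power_mono) auto
    then show ?thesis by (simp add: \<omega>_def flat_exp_def power2_norm_eq_inner)
  qed
  have cont: "continuous_on UNIV \<omega>" by (rule bump_class_continuous[OF b])
  have int: "integrable lborel \<omega>" by (rule integrable_continuous_compact_support[OF cont out])
  have "\<omega> 0 \<noteq> 0" using assms by (simp add: \<omega>_def flat_exp_def)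
  then have c: "(\<integral>x. \<omega> x \<partial>lborel) \<noteq> 0"
    using integral_eq_0_continuous_imp_zero[OF cont int nn] by blast
  have c0: "0 \<le> (\<integral>x. \<omega> x \<partial>lborel)" by (intro integral_nonneg_AE) (use nn in auto)
  show thesis
  proof
    show "bump_class \<rho> (\<lambda>x. (1 / (\<integral>x. \<omega> x \<partial>lborel)) * \<omega> x)" by (rule bump_class.scale[OF b])
  qed (use nn out int c c0 in auto)
qed

text \<open>Averaging translates against a probability density preserves the Lipschitz constant and
  moves values by at most \<open>K\<close> times the radius. The unchanged constant is what later
  provides a common majorant.\<close>

lemma lipschitz_mollification:
  fixes \<theta> :: "'a::euclidean_space \<Rightarrow> real"
  assumes lip: "\<And>x y. \<bar>\<theta> x - \<theta> y\<bar> \<le> K * norm (x - y)"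
    and supp: "\<And>x. R < norm x \<Longrightarrow> \<theta> x = 0" and \<rho>: "0 < \<rho>"
  obtains \<phi> where "\<phi> \<in> test_functions" "\<And>x y. \<bar>\<phi> x - \<phi> y\<bar> \<le> K * norm (x - y)"
    "\<And>x. \<bar>\<phi> x - \<theta> x\<bar> \<le> K * \<rho>" "\<And>x. R + \<rho> < norm x \<Longrightarrow> \<phi> x = 0"
proof -
  have K: "0 \<le> K"
  proof -
    obtain e :: 'a where e: "e \<in> Basis" using nonempty_Basis by blast
    show ?thesis using lip[of e 0] e by simp
  qed
  have cont: "continuous_on UNIV \<theta>"
  proof (rule lipschitz_on_continuous_on)
    show "K-lipschitz_on UNIV \<theta>" using lip K by (intro lipschitz_onI) (auto simp: dist_norm)
  qed
  obtain \<eta> :: "'a \<Rightarrow> real" where \<eta>: "bump_class \<rho> \<eta>" "\<And>x. 0 \<le> \<eta> x"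
    "\<And>x. \<rho> < norm x \<Longrightarrow> \<eta> x = 0" "integrable lborel \<eta>" "(\<integral>x. \<eta> x \<partial>lborel) = 1"
    using bump_exists[OF \<rho>] by blast
  have cont\<eta>: "continuous_on UNIV \<eta>" by (rule bump_class_continuous[OF \<eta>(1)])
  \<comment> \<open>A box containing the support of \<open>\<theta>\<close> links two forms of the
    convolution: the box integral, which can be differentiated, and the integral over the whole
    space, in which \<open>\<theta>\<close> is translated and the estimates are made.\<close>
  obtain a where a: "cball (0::'a) R \<subseteq> cbox (- a) a"
    using bounded_subset_cbox_symmetric[of "cball (0::'a) R"] by auto
  define \<phi> where "\<phi> x = integral (cbox (- a) a) (\<lambda>y. \<theta> y * \<eta> (x - y))" for x
  have \<phi>: "\<phi> x = (\<integral>z. \<theta> (x - z) * \<eta> z \<partial>lborel)" and int: "integrable lborel (\<lambda>z. \<theta> (x - z) * \<eta> z)" for x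
  proof -
    let ?f = "\<lambda>y. \<theta> y * \<eta> (x - y)"
    have c: "continuous_on UNIV ?f"
      by (intro continuous_intros cont continuous_on_compose2[OF cont\<eta>]) auto
    then have i: "integrable lborel ?f"
      using supp by (intro integrable_continuous_compact_support[of _ R]) auto
    have m: "?f \<in> borel_measurable borel" using c by (rule borel_measurable_continuous_onI)
    have "\<phi> x = integral UNIV (\<lambda>y. if y \<in> cbox (- a) a then ?f y else 0)"
      unfolding \<phi>_def by (rule integral_restrict_UNIV[symmetric])
    also have "(\<lambda>y. if y \<in> cbox (- a) a then ?f y else 0) = ?f"
      using a supp by (fastforce simp: subset_iff not_le)
    also have "integral UNIV ?f = (\<integral>y. ?f y \<partial>lborel)" by (rule integral_lborel[OF i])
    also have "\<dots> = (\<integral>z. ?f (x - z) \<partial>lborel)" by (rule integral_lborel_reflect[OF m, symmetric])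
    finally show "\<phi> x = (\<integral>z. \<theta> (x - z) * \<eta> z \<partial>lborel)" by simp
    have "integrable lborel (\<lambda>z. ?f (x - z))" using i integrable_lborel_reflect[OF m] by blast
    then show "integrable lborel (\<lambda>z. \<theta> (x - z) * \<eta> z)" by simp
  qed
  have bd: "\<bar>\<integral>z. f z * \<eta> z \<partial>lborel\<bar> \<le> B"
    if i: "integrable lborel (\<lambda>z. f z * \<eta> z)" and B: "\<And>z. norm z \<le> \<rho> \<Longrightarrow> \<bar>f z\<bar> \<le> B" for f B
  proof -
    have "\<bar>\<integral>z. f z * \<eta> z \<partial>lborel\<bar> \<le> (\<integral>z. \<bar>f z * \<eta> z\<bar> \<partial>lborel)"
      using integral_norm_bound[of lborel "\<lambda>z. f z * \<eta> z"] by simp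
    also have "\<dots> \<le> (\<integral>z. B * \<eta> z \<partial>lborel)"
    proof (rule integral_mono)
      show "\<bar>f z * \<eta> z\<bar> \<le> B * \<eta> z" for z
        using \<eta>(2)[of z] \<eta>(3)[of z] B[of z]
        by (cases "\<rho> < norm z") (auto simp: abs_mult intro: mult_right_mono)
    qed (use i \<eta> in auto)
    also have "\<dots> = B" using \<eta> by simp
    finally show ?thesis .
  qed
  have lip\<phi>: "\<bar>\<phi> x - \<phi> y\<bar> \<le> K * norm (x - y)" for x y
  proof -
    have "\<phi> x - \<phi> y = (\<integral>z. (\<theta> (x - z) - \<theta> (y - z)) * \<eta> z \<partial>lborel)"
      unfolding \<phi> using int by (simp add: left_diff_distrib)
    moreover have "\<bar>\<theta> (x - z) - \<theta> (y - z)\<bar> \<le> K * norm (x - y)" for z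
      using lip[of "x - z" "y - z"] by simp
    moreover have "integrable lborel (\<lambda>z. (\<theta> (x - z) - \<theta> (y - z)) * \<eta> z)"
      using int by (simp add: left_diff_distrib)
    ultimately show ?thesis using bd by simp
  qed
  have near: "\<bar>\<phi> x - \<theta> x\<bar> \<le> K * \<rho>" for x
  proof -
    have "\<phi> x - \<theta> x = (\<integral>z. (\<theta> (x - z) - \<theta> x) * \<eta> z \<partial>lborel)"
      unfolding \<phi> using int \<eta> by (simp add: left_diff_distrib)
    moreover have "\<bar>\<theta> (x - z) - \<theta> x\<bar> \<le> K * \<rho>" if "norm z \<le> \<rho>" for z
      using lip[of "x - z" x] mult_left_mono[OF that K] by simp
    moreover have "integrable lborel (\<lambda>z. (\<theta> (x - z) - \<theta> x) * \<eta> z)"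
      using int \<eta> by (simp add: left_diff_distrib)
    ultimately show ?thesis using bd by simp
  qed
  have out: "\<phi> x = 0" if x: "R + \<rho> < norm x" for x
  proof -
    have "\<theta> (x - z) * \<eta> z = 0" for z
      using \<eta>(3)[of z] supp[of "x - z"] x norm_triangle_ineq2[of x z] by (cases "\<rho> < norm z") auto
    then show ?thesis by (simp only: \<phi>) simp
  qed
  have smooth: "C_k k \<phi>" for k
    unfolding \<phi>_def[abs_def] by (rule C_k_convolution[OF \<eta>(1) cont])
  have "{x. \<phi> x \<noteq> 0} \<subseteq> cball 0 (R + \<rho>)"
  proof
    fix x assume "x \<in> {x. \<phi> x \<noteq> 0}"
    then show "x \<in> cball 0 (R + \<rho>)" using out[of x] by (cases "R + \<rho> < norm x") simp_all
  qed
  then have "bounded {x. \<phi> x \<noteq> 0}" by (rule bounded_subset[OF bounded_cball])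
  then have "\<phi> \<in> test_functions"
    using smooth by (simp add: test_functions_def compact_closure)
  then show thesis using that lip\<phi> near out by blast
qed

subsection \<open>Lipschitz test functions\<close>

definition energy_form :: "real \<Rightarrow> real \<Rightarrow> ('a::euclidean_space \<Rightarrow> real) \<Rightarrow> ('a \<Rightarrow> real) \<Rightarrow> 'a \<times> 'a \<Rightarrow> real" where
  "energy_form p \<sigma> u \<theta> = (\<lambda>(x, y). J p (u x - u y) * (\<theta> x - \<theta> y) / norm (x - y) powr (real DIM('a) + \<sigma>))"

text \<open>Dominates the integrand of the energy form as a function of \<open>w = x - y\<close>.
  With n the dimension it is |w|^(p - n - \<sigma>) near 0, integrable as \<sigma> < p, and |w|^(p -
  1 - n - \<sigma>) at infinity, integrable as p - 1 < \<sigma>. The factor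
  \<open>min (norm w) 1\<close> stands for a test function that is both Lipschitz and
  bounded.\<close>

definition majorant :: "real \<Rightarrow> real \<Rightarrow> 'a::euclidean_space \<Rightarrow> real" where
  "majorant p \<sigma> w = min (norm w) 1 * (norm w powr (p - 1) / norm w powr (real DIM('a) + \<sigma>))"

lemma majorant_nonneg: "0 \<le> majorant p \<sigma> w"
  by (simp add: majorant_def)

lemma majorant_minus: "majorant p \<sigma> (- w) = majorant p \<sigma> w"
  by (simp add: majorant_def)

lemma majorant_measurable [measurable]: "majorant p \<sigma> \<in> borel_measurable borel"
  unfolding majorant_def[abs_def] by measurable

lemma integrable_majorant:
  assumes "p - 1 < \<sigma>" "\<sigma> < p"
  shows "integrable lborel (majorant p \<sigma> :: 'a::euclidean_space \<Rightarrow> real)"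
proof -
  let ?d = "real DIM('a) + \<sigma>"
  have 1: "integrable lborel (\<lambda>z::'a. indicator {z. norm z < 1} z * norm z powr (p - ?d))"
    using assms by (intro integrable_norm_powr_inside) auto
  have 2: "integrable lborel (\<lambda>z::'a. indicator {z. 1 \<le> norm z} z * norm z powr (p - 1 - ?d))"
    using assms by (intro integrable_norm_powr_outside) auto
  show ?thesis
  proof (rule Bochner_Integration.integrable_bound[OF Bochner_Integration.integrable_add[OF 1 2]])
    show "AE w::'a in lborel. norm (majorant p \<sigma> w) \<le> norm (indicator {z. norm z < 1} w * norm w powr (p - ?d) +
         indicator {z. 1 \<le> norm z} w * norm w powr (p - 1 - ?d))"
    proof (rule AE_I2)
      fix w :: 'a
      have "norm w * norm w powr (p - 1 - ?d) = norm w powr (p - ?d)" if "w \<noteq> 0"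
        using powr_add[of "norm w" 1 "p - 1 - ?d"] that by (simp add: algebra_simps)
      then show "norm (majorant p \<sigma> w) \<le> norm (indicator {z. norm z < 1} w * norm w powr (p - ?d) +
         indicator {z. 1 \<le> norm z} w * norm w powr (p - 1 - ?d))"
        by (cases "w = 0"; cases "norm w < 1") (simp_all add: majorant_def powr_diff[symmetric])
    qed
  qed simp
qed

lemma integrable_lborel_pair_indicator:
  fixes h :: "'a::euclidean_space \<Rightarrow> real"
  assumes h: "integrable lborel h" "\<And>w. 0 \<le> h w" and [measurable]: "h \<in> borel_measurable borel"
  shows "integrable (lborel \<Otimes>\<^sub>M lborel) (\<lambda>(x, y). indicator {x. norm x \<le> R} x * h (x - y))"
proof (rule lborel_pair.Fubini_integrable)
  show "(\<lambda>(x, y). indicator {x. norm x \<le> R} x * h (x - y)) \<in> borel_measurable (lborel \<Otimes>\<^sub>M lborel)"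
    unfolding split_beta by measurable
  have i: "integrable lborel (\<lambda>y. h (x - y))" for x
    using integrable_lborel_reflect[of h x] h by simp
  then show "AE x in lborel. integrable lborel (\<lambda>y. case (x, y) of (x, y) \<Rightarrow> indicator {x. norm x \<le> R} x * h (x - y))"
    by simp
  have "(\<integral>y. norm (case (x, y) of (x, y) \<Rightarrow> indicator {x. norm x \<le> R} x * h (x - y)) \<partial>lborel)
     = indicator (cball 0 R) x * (\<integral>w. h w \<partial>lborel)" for x
    using h(2) integral_lborel_reflect[of h x] by (simp add: abs_mult indicator_def)
  moreover have "integrable lborel (\<lambda>x. indicator (cball (0::'a) R) x * (\<integral>w. h w \<partial>lborel))"
    using emeasure_bounded_finite[of "cball (0::'a) R"]
    by (intro integrable_mult_left integrable_real_indicator) auto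
  ultimately show "integrable lborel (\<lambda>x. \<integral>y. norm (case (x, y) of (x, y) \<Rightarrow> indicator {x. norm x \<le> R} x * h (x - y)) \<partial>lborel)"
    by simp
qed

text \<open>A difference of values of a test function vanishes unless one of the two points lies in
  the ball around its support; hence one indicator for each variable.\<close>

definition pair_majorant :: "real \<Rightarrow> real \<Rightarrow> real \<Rightarrow> 'a::euclidean_space \<times> 'a \<Rightarrow> real" where
  "pair_majorant p \<sigma> R = (\<lambda>(x, y). (indicator {x. norm x \<le> R} x + indicator {x. norm x \<le> R} y) * majorant p \<sigma> (x - y))"

lemma integrable_pair_majorant:
  assumes "p - 1 < \<sigma>" "\<sigma> < p"
  shows "integrable (lborel \<Otimes>\<^sub>M lborel) (pair_majorant p \<sigma> R :: 'a::euclidean_space \<times> 'a \<Rightarrow> real)"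
proof -
  let ?h = "\<lambda>(x, y). indicator {x. norm x \<le> R} x * majorant p \<sigma> (x - y :: 'a)"
  have 1: "integrable (lborel \<Otimes>\<^sub>M lborel) ?h"
    by (intro integrable_lborel_pair_indicator integrable_majorant assms majorant_nonneg) measurable
  have 2: "integrable (lborel \<Otimes>\<^sub>M lborel) (\<lambda>(x, y). ?h (y, x))"
    by (rule lborel_pair.integrable_product_swap[OF 1])
  have "pair_majorant p \<sigma> R (x, y) = ?h (x, y) + ?h (y, x)" for x y :: 'a
    using majorant_minus[of p \<sigma> "x - y"] by (simp add: pair_majorant_def algebra_simps)
  then have "pair_majorant p \<sigma> R = (\<lambda>z. ?h z + (\<lambda>(x, y). ?h (y, x)) z)"
    by (auto simp: fun_eq_iff)
  then show ?thesis using Bochner_Integration.integrable_add[OF 1 2] by simp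
qed

lemma abs_J_diff_le:
  assumes "1 < p" "\<bar>u x - u y\<bar> \<le> K * norm (x - y)" "0 \<le> K"
  shows "\<bar>J p (u x - u y)\<bar> \<le> K powr (p - 1) * norm (x - y) powr (p - 1)"
  using assms by (auto simp: abs_J powr_mult[symmetric] intro!: powr_mono2)

text \<open>The constant \<open>K' + 2 * B\<close> serves both regimes of the minimum: the Lipschitz
  bound for points at distance at most 1, twice the sup bound for the others.\<close>

lemma energy_form_bound:
  fixes u :: "'a::euclidean_space \<Rightarrow> real"
  assumes p: "1 < p"
    and u: "\<And>x y. \<bar>u x - u y\<bar> \<le> K * norm (x - y)"
    and \<theta>: "\<And>x y. \<bar>\<theta> x - \<theta> y\<bar> \<le> K' * norm (x - y)" "\<And>x. \<bar>\<theta> x\<bar> \<le> B" "\<And>x. R < norm x \<Longrightarrow> \<theta> x = 0"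
    and K: "0 \<le> K" "0 \<le> K'"
  shows "\<bar>energy_form p \<sigma> u \<theta> z\<bar> \<le> K powr (p - 1) * (K' + 2 * B) * pair_majorant p \<sigma> R z"
proof (cases z)
  case (Pair x y)
  have B: "0 \<le> B" using \<theta>(2)[of 0] by linarith
  have J: "\<bar>J p (u x - u y)\<bar> \<le> K powr (p - 1) * norm (x - y) powr (p - 1)"
    by (rule abs_J_diff_le[OF p u K(1)])
  let ?I = "indicator {x. norm x \<le> R} x + indicator {x. norm x \<le> R} y :: real"
  have t: "\<bar>\<theta> x - \<theta> y\<bar> \<le> (K' + 2 * B) * min (norm (x - y)) 1"
  proof (cases "norm (x - y) \<le> 1")
    case True
    then have "K' * norm (x - y) \<le> (K' + 2 * B) * norm (x - y)" using B by (intro mult_right_mono) auto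
    then show ?thesis using \<theta>(1)[of x y] True by (simp add: min_def)
  next
    case False
    then show ?thesis using \<theta>(2)[of x] \<theta>(2)[of y] K by (simp add: min_def)
  qed
  have "\<bar>\<theta> x - \<theta> y\<bar> \<le> ?I * ((K' + 2 * B) * min (norm (x - y)) 1)"
  proof (cases "norm x \<le> R \<or> norm y \<le> R")
    case True
    have "1 * ((K' + 2 * B) * min (norm (x - y)) 1) \<le> ?I * ((K' + 2 * B) * min (norm (x - y)) 1)"
      using True K B by (intro mult_right_mono) (auto simp: indicator_def)
    then show ?thesis using t by simp
  next
    case False
    then show ?thesis using \<theta>(3) by simp
  qed
  with J have "\<bar>J p (u x - u y)\<bar> * \<bar>\<theta> x - \<theta> y\<bar> \<le>
      (K powr (p - 1) * norm (x - y) powr (p - 1)) * (?I * ((K' + 2 * B) * min (norm (x - y)) 1))"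
    by (intro mult_mono) auto
  then have "\<bar>J p (u x - u y)\<bar> * \<bar>\<theta> x - \<theta> y\<bar> / norm (x - y) powr (real DIM('a) + \<sigma>) \<le>
      (K powr (p - 1) * norm (x - y) powr (p - 1)) * (?I * ((K' + 2 * B) * min (norm (x - y)) 1)) / norm (x - y) powr (real DIM('a) + \<sigma>)"
    by (intro divide_right_mono) auto
  then show ?thesis
    by (simp add: Pair energy_form_def pair_majorant_def majorant_def abs_mult mult_ac)
qed

lemma energy_form_measurable:
  assumes [measurable]: "u \<in> borel_measurable borel" "\<theta> \<in> borel_measurable borel"
  shows "energy_form p \<sigma> u \<theta> \<in> borel_measurable (lborel \<Otimes>\<^sub>M lborel)"
  unfolding energy_form_def split_beta by measurable

lemma lipschitz_continuous:
  fixes u :: "'a::euclidean_space \<Rightarrow> real"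
  assumes "\<And>x y. \<bar>u x - u y\<bar> \<le> K * norm (x - y)"
  shows "continuous_on UNIV u"
proof (rule lipschitz_on_continuous_on)
  have "\<bar>u x - u y\<bar> \<le> \<bar>K\<bar> * norm (x - y)" for x y
    using assms[of x y] mult_right_mono[OF abs_ge_self[of K] norm_ge_zero[of "x - y"]] by linarith
  then show "\<bar>K\<bar>-lipschitz_on UNIV u" by (intro lipschitz_onI) (auto simp: dist_norm)
qed

text \<open>Moves the equation from \<open>lebesgue\<close> on the product space to a product
  measure, where Fubini and the exchange of variables apply; continuity of \<open>U\<close> supplies
  the Borel measurability that this needs.\<close>

lemma weak_solution_energy_form:
  fixes U :: "'a::euclidean_space \<Rightarrow> real"
  assumes "entire_weak_solution s p U" "continuous_on UNIV U" "\<phi> \<in> test_functions"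
  shows "(\<integral>z. energy_form p (s * p) U \<phi> z \<partial>(lborel \<Otimes>\<^sub>M lborel)) = 0"
proof -
  have "continuous_on UNIV \<phi>" using assms(3) by (auto simp: test_functions_def dest: spec[of _ 0])
  then have "energy_form p (s * p) U \<phi> \<in> borel_measurable (lborel \<Otimes>\<^sub>M lborel)"
    using assms(2) by (intro energy_form_measurable borel_measurable_continuous_onI)
  then have m: "energy_form p (s * p) U \<phi> \<in> borel_measurable lborel" by (simp add: lborel_prod)
  have "has_bochner_integral lebesgue (energy_form p (s * p) U \<phi>) 0"
    using assms(1,3) by (simp add: entire_weak_solution_def energy_form_def)
  then have "(\<integral>z. energy_form p (s * p) U \<phi> z \<partial>lebesgue) = 0" by (rule has_bochner_integral_integral_eq)
  then show ?thesis using integral_completion[OF m] by (simp add: lborel_prod)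
qed

text \<open>Extends the class of test functions to Lipschitz ones, by dominated convergence along
  mollifications of radius 1 / (k + 1).\<close>

lemma weak_solution_lipschitz_test:
  fixes U :: "'a::euclidean_space \<Rightarrow> real"
  assumes p: "1 < p" and \<sigma>: "p - 1 < \<sigma>" "\<sigma> < p"
    and weak: "\<And>\<phi>. \<phi> \<in> test_functions \<Longrightarrow> (\<integral>z. energy_form p \<sigma> U \<phi> z \<partial>(lborel \<Otimes>\<^sub>M lborel)) = 0"
    and U: "\<And>x y. \<bar>U x - U y\<bar> \<le> K * norm (x - y)"
    and \<theta>: "\<And>x y. \<bar>\<theta> x - \<theta> y\<bar> \<le> K' * norm (x - y)" "\<And>x. \<bar>\<theta> x\<bar> \<le> B" "\<And>x. R < norm x \<Longrightarrow> \<theta> x = 0"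
    and K: "0 \<le> K" "0 \<le> K'"
  shows "(\<integral>z. energy_form p \<sigma> U \<theta> z \<partial>(lborel \<Otimes>\<^sub>M lborel)) = 0"
proof -
  define \<rho> where "\<rho> k = 1 / real (Suc k)" for k
  have \<rho>: "0 < \<rho> k" "\<rho> k \<le> 1" for k by (auto simp: \<rho>_def)
  have "\<exists>\<phi>. \<phi> \<in> test_functions \<and> (\<forall>x y. \<bar>\<phi> x - \<phi> y\<bar> \<le> K' * norm (x - y)) \<and>
     (\<forall>x. \<bar>\<phi> x - \<theta> x\<bar> \<le> K' * \<rho> k) \<and> (\<forall>x. R + \<rho> k < norm x \<longrightarrow> \<phi> x = 0)" for k
    by (rule lipschitz_mollification[OF \<theta>(1) \<theta>(3) \<rho>(1)[of k]]) auto
  then obtain \<phi> where \<phi>: "\<And>k. \<phi> k \<in> test_functions"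
     "\<And>k x y. \<bar>\<phi> k x - \<phi> k y\<bar> \<le> K' * norm (x - y)"
     "\<And>k x. \<bar>\<phi> k x - \<theta> x\<bar> \<le> K' * \<rho> k" "\<And>k x. R + \<rho> k < norm x \<Longrightarrow> \<phi> k x = 0"
    by metis
  have Um: "U \<in> borel_measurable borel" by (rule borel_measurable_continuous_onI[OF lipschitz_continuous[OF U]])
  have lim\<rho>: "(\<lambda>k. K' * \<rho> k) \<longlonglongrightarrow> 0"
    unfolding \<rho>_def using tendsto_mult_right_zero[OF LIMSEQ_Suc[OF lim_1_over_n], of K'] by simp
  have lim: "(\<lambda>k. \<phi> k x) \<longlonglongrightarrow> \<theta> x" for x
  proof -
    have "(\<lambda>k. \<phi> k x - \<theta> x) \<longlonglongrightarrow> 0"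
      by (rule Lim_null_comparison[OF _ lim\<rho>]) (use \<phi>(3) in simp)
    then show ?thesis by (simp add: LIM_zero_iff)
  qed
  \<comment> \<open>Radii are at most 1, so one sup bound \<open>B + K'\<close> and one support
    radius \<open>R + 1\<close> serve every \<open>k\<close>.\<close>
  have bd: "\<bar>energy_form p \<sigma> U (\<phi> k) z\<bar> \<le> K powr (p - 1) * (K' + 2 * (B + K')) * pair_majorant p \<sigma> (R + 1) z" for k z
  proof (rule energy_form_bound[OF p U \<phi>(2) _ _ K])
    show "\<bar>\<phi> k x\<bar> \<le> B + K'" for x
      using \<phi>(3)[of k x] \<theta>(2)[of x] mult_left_mono[OF \<rho>(2)[of k] K(2)] by simp
    show "\<phi> k x = 0" if "R + 1 < norm x" for x
      using \<phi>(4)[where k = k and x = x] \<rho>(2)[of k] that by simp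
  qed
  have "(\<lambda>k. \<integral>z. energy_form p \<sigma> U (\<phi> k) z \<partial>(lborel \<Otimes>\<^sub>M lborel)) \<longlonglongrightarrow> (\<integral>z. energy_form p \<sigma> U \<theta> z \<partial>(lborel \<Otimes>\<^sub>M lborel))"
  proof (rule integral_dominated_convergence)
    show "energy_form p \<sigma> U \<theta> \<in> borel_measurable (lborel \<Otimes>\<^sub>M lborel)"
      by (intro energy_form_measurable Um borel_measurable_continuous_onI[OF lipschitz_continuous[OF \<theta>(1)]])
    show "energy_form p \<sigma> U (\<phi> k) \<in> borel_measurable (lborel \<Otimes>\<^sub>M lborel)" for k
      by (intro energy_form_measurable Um borel_measurable_continuous_onI[OF lipschitz_continuous[OF \<phi>(2)]])
    show "integrable (lborel \<Otimes>\<^sub>M lborel) (\<lambda>z. K powr (p - 1) * (K' + 2 * (B + K')) * pair_majorant p \<sigma> (R + 1) z)"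
      by (intro integrable_mult_right integrable_pair_majorant \<sigma>)
    show "AE z in lborel \<Otimes>\<^sub>M lborel. (\<lambda>k. energy_form p \<sigma> U (\<phi> k) z) \<longlonglongrightarrow> energy_form p \<sigma> U \<theta> z"
      unfolding energy_form_def split_beta divide_inverse
      by (intro AE_I2 tendsto_mult tendsto_const tendsto_diff lim)
  qed (use bd in auto)
  then show ?thesis using weak[OF \<phi>(1)] by (simp add: LIMSEQ_const_iff)
qed

subsection \<open>Truncation and comparison\<close>

definition jump_quotient :: "real \<Rightarrow> real \<Rightarrow> ('a::euclidean_space \<Rightarrow> real) \<Rightarrow> 'a \<Rightarrow> 'a \<Rightarrow> real" where
  "jump_quotient p \<sigma> u x z = J p (u x - u (x + z)) / norm z powr (real DIM('a) + \<sigma>)"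

text \<open>Linear growth of \<open>f\<close> leaves |z|^(p - 1 - n - \<sigma>) with n the
  dimension, integrable at infinity because p - 1 < \<sigma>. The cut-off at \<open>\<tau>\<close>
  is essential for this bound, since that power is not integrable at 0.\<close>

lemma integrable_J_quotient:
  fixes f :: "'a::euclidean_space \<Rightarrow> real"
  assumes p: "1 < p" and \<sigma>: "p - 1 < \<sigma>" and \<tau>: "0 < \<tau>"
    and [measurable]: "f \<in> borel_measurable borel" "A \<in> sets borel"
    and A: "\<And>z. z \<in> A \<Longrightarrow> \<tau> \<le> norm z" and f: "\<And>z. z \<in> A \<Longrightarrow> \<bar>f z\<bar> \<le> c * norm z" and c: "0 \<le> c"
  shows "integrable lborel (\<lambda>z. indicator A z * (J p (f z) / norm z powr (real DIM('a) + \<sigma>)))"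
proof (rule Bochner_Integration.integrable_bound)
  let ?d = "real DIM('a) + \<sigma>"
  show "integrable lborel (\<lambda>z. c powr (p - 1) * (indicator {z. \<tau> \<le> norm z} z * norm (z::'a) powr (p - 1 - ?d)))"
    using \<sigma> \<tau> by (intro integrable_mult_right integrable_norm_powr_outside) auto
  show "AE z in lborel. norm (indicator A z * (J p (f z) / norm z powr ?d)) \<le>
      norm (c powr (p - 1) * (indicator {z. \<tau> \<le> norm z} z * norm z powr (p - 1 - ?d)))"
  proof (rule AE_I2)
    fix z :: 'a
    show "norm (indicator A z * (J p (f z) / norm z powr ?d)) \<le>
      norm (c powr (p - 1) * (indicator {z. \<tau> \<le> norm z} z * norm z powr (p - 1 - ?d)))"
    proof (cases "z \<in> A")
      case True
      have "\<bar>f z\<bar> powr (p - 1) \<le> (c * norm z) powr (p - 1)"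
        using f[OF True] p by (intro powr_mono2) auto
      then have "\<bar>f z\<bar> powr (p - 1) / norm z powr ?d \<le> c powr (p - 1) * norm z powr (p - 1) / norm z powr ?d"
        using c by (intro divide_right_mono) (auto simp: powr_mult)
      then show ?thesis using True A[OF True] by (simp add: abs_mult abs_J powr_diff)
    qed simp
  qed
qed measurable

lemma
  fixes u :: "'a::euclidean_space \<Rightarrow> real"
  assumes p: "1 < p" and \<sigma>: "p - 1 < \<sigma>" and \<tau>: "0 < \<tau>"
    and u: "\<And>x y. \<bar>u x - u y\<bar> \<le> K * norm (x - y)" and K: "0 \<le> K"
  shows integrable_jump_quotient: "integrable lborel (\<lambda>z. indicator {z. \<tau> \<le> norm z} z * jump_quotient p \<sigma> u x z)"
    and integrable_jump_quotient': "integrable lborel (\<lambda>z. indicator {z. \<tau> < norm z} z * jump_quotient p \<sigma> u x z)"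
proof -
  have [measurable]: "u \<in> borel_measurable borel"
    by (rule borel_measurable_continuous_onI[OF lipschitz_continuous[OF u]])
  have b: "\<bar>u x - u (x + z)\<bar> \<le> K * norm z" for z using u[of x "x + z"] by simp
  show "integrable lborel (\<lambda>z. indicator {z. \<tau> \<le> norm z} z * jump_quotient p \<sigma> u x z)"
    "integrable lborel (\<lambda>z. indicator {z. \<tau> < norm z} z * jump_quotient p \<sigma> u x z)"
    unfolding jump_quotient_def
    by (intro integrable_J_quotient[OF p \<sigma> \<tau> _ _ _ _ K] b; simp)+
qed

definition truncated_form :: "real \<Rightarrow> real \<Rightarrow> real \<Rightarrow> ('a::euclidean_space \<Rightarrow> real) \<Rightarrow> ('a \<Rightarrow> real) \<Rightarrow> 'a \<times> 'a \<Rightarrow> real" where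
  "truncated_form p \<sigma> \<tau> u \<theta> = (\<lambda>z. indicator {z. \<tau> < norm (fst z - snd z)} z * energy_form p \<sigma> u \<theta> z)"

text \<open>The parts of the energy form that carry \<open>\<theta> x\<close> and
  \<open>\<theta> y\<close> need not be integrable separately near the diagonal. Once a strip around
  it is removed they are, and exchanging the variables turns one into the other because
  \<open>J p\<close> is odd. This is the factor 2.\<close>

lemma
  fixes m \<theta> :: "'a::euclidean_space \<Rightarrow> real"
  assumes p: "1 < p" and \<sigma>: "p - 1 < \<sigma>" and \<tau>: "0 < \<tau>"
    and m: "\<And>x y. \<bar>m x - m y\<bar> \<le> K * norm (x - y)" and K: "0 \<le> K"
    and \<theta>: "continuous_on UNIV \<theta>" "\<And>x. \<bar>\<theta> x\<bar> \<le> B" "\<And>x. R < norm x \<Longrightarrow> \<theta> x = 0"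
  shows integrable_truncated_potential:
      "integrable lborel (\<lambda>x. \<theta> x * (\<integral>z. indicator {z. \<tau> < norm z} z * jump_quotient p \<sigma> m x z \<partial>lborel))"
    and integral_truncated_form: "(\<integral>z. truncated_form p \<sigma> \<tau> m \<theta> z \<partial>(lborel \<Otimes>\<^sub>M lborel)) =
      2 * (\<integral>x. \<theta> x * (\<integral>z. indicator {z. \<tau> < norm z} z * jump_quotient p \<sigma> m x z \<partial>lborel) \<partial>lborel)"
proof -
  let ?d = "real DIM('a) + \<sigma>"
  have [measurable]: "m \<in> borel_measurable borel"
    by (rule borel_measurable_continuous_onI[OF lipschitz_continuous[OF m]])
  have [measurable]: "\<theta> \<in> borel_measurable borel"
    by (rule borel_measurable_continuous_onI[OF \<theta>(1)])
  define h where "h w = indicator {w. \<tau> \<le> norm w} w * norm w powr (p - 1 - ?d)" for w :: 'a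
  have [measurable]: "h \<in> borel_measurable borel" unfolding h_def by measurable
  define H where "H = (\<lambda>(x, y). \<theta> x * (indicator {w. \<tau> < norm w} (y - x) * (J p (m x - m y) / norm (y - x) powr ?d)))"
  have Hm: "H \<in> borel_measurable (lborel \<Otimes>\<^sub>M lborel)"
    unfolding H_def split_beta by measurable
  have H: "integrable (lborel \<Otimes>\<^sub>M lborel) H"
  proof (rule Bochner_Integration.integrable_bound[OF _ Hm])
    have "integrable lborel h" unfolding h_def
      using \<sigma> \<tau> by (intro integrable_norm_powr_outside) auto
    then show "integrable (lborel \<Otimes>\<^sub>M lborel)
        (\<lambda>z. (B * K powr (p - 1)) * (case z of (x, y) \<Rightarrow> indicator {x. norm x \<le> R} x * h (x - y)))"
      by (intro integrable_mult_right integrable_lborel_pair_indicator) (auto simp: h_def[abs_def])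
    show "AE z in lborel \<Otimes>\<^sub>M lborel. norm (H z) \<le>
       norm ((B * K powr (p - 1)) * (case z of (x, y) \<Rightarrow> indicator {x. norm x \<le> R} x * h (x - y)))"
    proof (rule AE_I2)
      fix z :: "'a \<times> 'a"
      obtain x y where z: "z = (x, y)" by (cases z)
      show "norm (H z) \<le> norm ((B * K powr (p - 1)) * (case z of (x, y) \<Rightarrow> indicator {x. norm x \<le> R} x * h (x - y)))"
      proof (cases "norm x \<le> R \<and> \<tau> < norm (x - y)")
        case True
        have B: "0 \<le> B" using \<theta>(2)[of x] by linarith
        have "\<bar>J p (m x - m y)\<bar> / norm (x - y) powr ?d \<le> (K powr (p - 1) * norm (x - y) powr (p - 1)) / norm (x - y) powr ?d"
          by (intro divide_right_mono abs_J_diff_le[OF p m K]) auto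
        then have "\<bar>\<theta> x\<bar> * (\<bar>J p (m x - m y)\<bar> / norm (x - y) powr ?d) \<le> B * ((K powr (p - 1) * norm (x - y) powr (p - 1)) / norm (x - y) powr ?d)"
          using \<theta>(2)[of x] B by (intro mult_mono) auto
        then show ?thesis using True B
          by (simp add: z H_def h_def abs_mult powr_diff norm_minus_commute mult_ac)
      next
        case False
        then show ?thesis using \<theta>(3)[of x] by (auto simp: z H_def norm_minus_commute not_le)
      qed
    qed
  qed
  have swap: "integrable (lborel \<Otimes>\<^sub>M lborel) (\<lambda>(x, y). H (y, x))"
    by (rule lborel_pair.integrable_product_swap[OF H])
  have eq: "truncated_form p \<sigma> \<tau> m \<theta> z = H z + (\<lambda>(x, y). H (y, x)) z" for z
  proof -
    obtain x y where z: "z = (x, y)" by (cases z)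
    have "J p (m y - m x) = - J p (m x - m y)" using J_minus[of p "m x - m y"] by simp
    then show ?thesis
      by (simp add: z truncated_form_def energy_form_def H_def norm_minus_commute[of y x] indicator_def
          diff_divide_distrib left_diff_distrib right_diff_distrib mult.commute)
  qed
  have inner: "(\<integral>y. H (x, y) \<partial>lborel) = \<theta> x * (\<integral>z. indicator {z. \<tau> < norm z} z * jump_quotient p \<sigma> m x z \<partial>lborel)" for x
  proof -
    let ?f = "\<lambda>y. \<theta> x * (indicator {w. \<tau> < norm w} (y - x) * (J p (m x - m y) / norm (y - x) powr ?d))"
    have "?f \<in> borel_measurable borel" by measurable
    from integral_lborel_translate[OF this, of x]
    have "(\<integral>y. H (x, y) \<partial>lborel) = (\<integral>z. \<theta> x * (indicator {z. \<tau> < norm z} z * jump_quotient p \<sigma> m x z) \<partial>lborel)"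
      unfolding H_def jump_quotient_def prod.case add_diff_cancel_left' by (rule sym)
    then show ?thesis by (simp only: integral_mult_right_zero)
  qed
  show "integrable lborel (\<lambda>x. \<theta> x * (\<integral>z. indicator {z. \<tau> < norm z} z * jump_quotient p \<sigma> m x z \<partial>lborel))"
    using lborel_pair.integrable_fst'[OF H] by (simp add: inner)
  have "(\<integral>z. truncated_form p \<sigma> \<tau> m \<theta> z \<partial>(lborel \<Otimes>\<^sub>M lborel)) =
      (\<integral>z. H z \<partial>(lborel \<Otimes>\<^sub>M lborel)) + (\<integral>z. (\<lambda>(x, y). H (y, x)) z \<partial>(lborel \<Otimes>\<^sub>M lborel))"
    unfolding eq by (rule Bochner_Integration.integral_add[OF H swap])
  also have "(\<integral>z. (\<lambda>(x, y). H (y, x)) z \<partial>(lborel \<Otimes>\<^sub>M lborel)) = (\<integral>z. H z \<partial>(lborel \<Otimes>\<^sub>M lborel))"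
    by (rule lborel_pair.integral_product_swap[OF Hm])
  also have "(\<integral>z. H z \<partial>(lborel \<Otimes>\<^sub>M lborel)) = (\<integral>x. (\<integral>y. H (x, y) \<partial>lborel) \<partial>lborel)"
    by (rule lborel_pair.integral_fst'[OF H, symmetric])
  finally show "(\<integral>z. truncated_form p \<sigma> \<tau> m \<theta> z \<partial>(lborel \<Otimes>\<^sub>M lborel)) =
      2 * (\<integral>x. \<theta> x * (\<integral>z. indicator {z. \<tau> < norm z} z * jump_quotient p \<sigma> m x z \<partial>lborel) \<partial>lborel)"
    by (simp add: inner)
qed

text \<open>The factor \<open>\<theta> x - \<theta> y\<close> makes the full form integrable up to
  the diagonal, so it dominates its own truncations.\<close>

lemma truncated_form_tendsto:
  fixes m \<theta> :: "'a::euclidean_space \<Rightarrow> real"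
  assumes p: "1 < p" and \<sigma>: "p - 1 < \<sigma>" "\<sigma> < p"
    and m: "\<And>x y. \<bar>m x - m y\<bar> \<le> K * norm (x - y)"
    and \<theta>: "\<And>x y. \<bar>\<theta> x - \<theta> y\<bar> \<le> K' * norm (x - y)" "\<And>x. \<bar>\<theta> x\<bar> \<le> B" "\<And>x. R < norm x \<Longrightarrow> \<theta> x = 0"
    and K: "0 \<le> K" "0 \<le> K'" and \<tau>: "\<tau> \<longlonglongrightarrow> 0"
  shows "(\<lambda>k. \<integral>z. truncated_form p \<sigma> (\<tau> k) m \<theta> z \<partial>(lborel \<Otimes>\<^sub>M lborel)) \<longlonglongrightarrow> (\<integral>z. energy_form p \<sigma> m \<theta> z \<partial>(lborel \<Otimes>\<^sub>M lborel))"
proof (rule integral_dominated_convergence)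
  show f [measurable]: "energy_form p \<sigma> m \<theta> \<in> borel_measurable (lborel \<Otimes>\<^sub>M lborel)"
    by (intro energy_form_measurable borel_measurable_continuous_onI[OF lipschitz_continuous[OF m]]
        borel_measurable_continuous_onI[OF lipschitz_continuous[OF \<theta>(1)]])
  show "truncated_form p \<sigma> (\<tau> k) m \<theta> \<in> borel_measurable (lborel \<Otimes>\<^sub>M lborel)" for k
    unfolding truncated_form_def by measurable
  show "integrable (lborel \<Otimes>\<^sub>M lborel) (\<lambda>z. K powr (p - 1) * (K' + 2 * B) * pair_majorant p \<sigma> R z)"
    by (intro integrable_mult_right integrable_pair_majorant \<sigma>)
  show "AE z in lborel \<Otimes>\<^sub>M lborel. norm (truncated_form p \<sigma> (\<tau> k) m \<theta> z) \<le> K powr (p - 1) * (K' + 2 * B) * pair_majorant p \<sigma> R z" for k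
  proof (rule AE_I2)
    fix z
    have "norm (truncated_form p \<sigma> (\<tau> k) m \<theta> z) \<le> \<bar>energy_form p \<sigma> m \<theta> z\<bar>"
      by (simp add: truncated_form_def indicator_def)
    also have "\<dots> \<le> K powr (p - 1) * (K' + 2 * B) * pair_majorant p \<sigma> R z"
      by (rule energy_form_bound[OF p m \<theta> K])
    finally show "norm (truncated_form p \<sigma> (\<tau> k) m \<theta> z) \<le> K powr (p - 1) * (K' + 2 * B) * pair_majorant p \<sigma> R z" .
  qed
  show "AE z in lborel \<Otimes>\<^sub>M lborel. (\<lambda>k. truncated_form p \<sigma> (\<tau> k) m \<theta> z) \<longlonglongrightarrow> energy_form p \<sigma> m \<theta> z"
  proof (rule AE_I2)
    fix z :: "'a \<times> 'a"
    show "(\<lambda>k. truncated_form p \<sigma> (\<tau> k) m \<theta> z) \<longlonglongrightarrow> energy_form p \<sigma> m \<theta> z"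
    proof (cases "fst z = snd z")
      case True
      then show ?thesis by (simp add: truncated_form_def energy_form_def split_beta)
    next
      case False
      have "\<forall>\<^sub>F k in sequentially. \<tau> k < norm (fst z - snd z)"
        using False by (intro order_tendstoD(2)[OF \<tau>]) auto
      then have "\<forall>\<^sub>F k in sequentially. truncated_form p \<sigma> (\<tau> k) m \<theta> z = energy_form p \<sigma> m \<theta> z"
        by eventually_elim (simp add: truncated_form_def)
      then show ?thesis by (rule tendsto_eventually)
    qed
  qed
qed

text \<open>Testing with \<open>\<theta>\<close> and using that \<open>J p\<close> is increasing, the form of \<open>U + \<theta>\<close> against \<open>\<theta>\<close> is
  nonnegative, whereas a negative truncated operator on the support of \<open>\<theta>\<close> makes it negative.\<close>

lemma weak_comparison:
  fixes U \<theta> :: "'a::euclidean_space \<Rightarrow> real"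
  assumes p: "1 < p" and \<sigma>: "p - 1 < \<sigma>" "\<sigma> < p"
    and weak: "\<And>\<phi>. \<phi> \<in> test_functions \<Longrightarrow> (\<integral>z. energy_form p \<sigma> U \<phi> z \<partial>(lborel \<Otimes>\<^sub>M lborel)) = 0"
    and U: "\<And>x y. \<bar>U x - U y\<bar> \<le> K * norm (x - y)"
    and \<theta>: "\<And>x y. \<bar>\<theta> x - \<theta> y\<bar> \<le> K' * norm (x - y)" "\<And>x. \<bar>\<theta> x\<bar> \<le> B" "\<And>x. R < norm x \<Longrightarrow> \<theta> x = 0"
    and K: "0 \<le> K" "0 \<le> K'" and nn: "\<And>x. 0 \<le> \<theta> x"
    and \<delta>: "0 < \<delta>" and r: "0 < r"
    and neg: "\<And>x \<tau>. 0 < \<theta> x \<Longrightarrow> 0 < \<tau> \<Longrightarrow> \<tau> < r \<Longrightarrow>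
      (\<integral>z. indicator {z. \<tau> < norm z} z * jump_quotient p \<sigma> (\<lambda>x. U x + \<theta> x) x z \<partial>lborel) \<le> - \<delta>"
  shows "\<theta> x = 0"
proof -
  let ?m = "\<lambda>x. U x + \<theta> x"
  have m: "\<bar>?m x - ?m y\<bar> \<le> (K + K') * norm (x - y)" for x y
    using U[of x y] \<theta>(1)[of x y] by (simp add: distrib_right)
  have KK: "0 \<le> K + K'" using K by simp
  have cont: "continuous_on UNIV \<theta>" by (rule lipschitz_continuous[OF \<theta>(1)])
  have int\<theta>: "integrable lborel \<theta>" by (rule integrable_continuous_compact_support[OF cont \<theta>(3)])
  have Um: "U \<in> borel_measurable borel" by (rule borel_measurable_continuous_onI[OF lipschitz_continuous[OF U]])
  have mm: "?m \<in> borel_measurable borel" by (rule borel_measurable_continuous_onI[OF lipschitz_continuous[OF m]])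
  have \<theta>m: "\<theta> \<in> borel_measurable borel" by (rule borel_measurable_continuous_onI[OF cont])
  have int_energy: "integrable (lborel \<Otimes>\<^sub>M lborel) (energy_form p \<sigma> u \<theta>)"
    if "\<And>x y. \<bar>u x - u y\<bar> \<le> k * norm (x - y)" "0 \<le> k" "u \<in> borel_measurable borel" for u :: "'a \<Rightarrow> real" and k
  proof (rule Bochner_Integration.integrable_bound)
    show "integrable (lborel \<Otimes>\<^sub>M lborel) (\<lambda>z. k powr (p - 1) * (K' + 2 * B) * pair_majorant p \<sigma> R z :: real)"
      by (intro integrable_mult_right integrable_pair_majorant \<sigma>)
    show "AE z in lborel \<Otimes>\<^sub>M lborel. norm (energy_form p \<sigma> u \<theta> z) \<le> norm (k powr (p - 1) * (K' + 2 * B) * pair_majorant p \<sigma> R z)"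
      using energy_form_bound[OF p that(1) \<theta> that(2) K(2)] by (intro AE_I2) (metis abs_ge_self order_trans real_norm_def)
  qed (rule energy_form_measurable[OF that(3) \<theta>m])
  have "energy_form p \<sigma> U \<theta> z \<le> energy_form p \<sigma> ?m \<theta> z" for z
  proof -
    obtain x y where z: "z = (x, y)" by (cases z)
    have "J p (U x - U y) * (\<theta> x - \<theta> y) \<le> J p (?m x - ?m y) * (\<theta> x - \<theta> y)"
      using J_mono[OF p, of "U x - U y" "?m x - ?m y"] J_mono[OF p, of "?m x - ?m y" "U x - U y"]
      by (cases "\<theta> y \<le> \<theta> x") (auto intro: mult_right_mono mult_right_mono_neg)
    then show ?thesis unfolding z energy_form_def by (simp add: divide_right_mono)
  qed
  then have "(\<integral>z. energy_form p \<sigma> U \<theta> z \<partial>(lborel \<Otimes>\<^sub>M lborel)) \<le> (\<integral>z. energy_form p \<sigma> ?m \<theta> z \<partial>(lborel \<Otimes>\<^sub>M lborel))"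
    by (intro integral_mono int_energy[OF U K(1) Um] int_energy[OF m KK mm])
  then have ge: "0 \<le> (\<integral>z. energy_form p \<sigma> ?m \<theta> z \<partial>(lborel \<Otimes>\<^sub>M lborel))"
    using weak_solution_lipschitz_test[OF p \<sigma> weak U \<theta> K] by simp
  \<comment> \<open>The double successor keeps \<open>\<tau> k\<close> strictly below
    \<open>r\<close> already for \<open>k = 0\<close>, as \<open>neg\<close> demands.\<close>
  define \<tau> where "\<tau> k = r / real (Suc (Suc k))" for k
  have \<tau>: "0 < \<tau> k" "\<tau> k < r" for k using r by (auto simp: \<tau>_def divide_less_eq)
  have "(\<lambda>k. r * (1 / real (Suc (Suc k)))) \<longlonglongrightarrow> r * 0"
    by (intro tendsto_mult tendsto_const LIMSEQ_Suc[OF LIMSEQ_Suc[OF lim_1_over_n]])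
  then have \<tau>0: "\<tau> \<longlonglongrightarrow> 0" by (simp add: \<tau>_def[abs_def])
  have le: "(\<integral>z. truncated_form p \<sigma> (\<tau> k) ?m \<theta> z \<partial>(lborel \<Otimes>\<^sub>M lborel)) \<le> - (2 * \<delta> * (\<integral>x. \<theta> x \<partial>lborel))" for k
  proof -
    let ?I = "\<lambda>x. \<integral>z. indicator {z. \<tau> k < norm z} z * jump_quotient p \<sigma> ?m x z \<partial>lborel"
    have "(\<integral>x. \<theta> x * ?I x \<partial>lborel) \<le> (\<integral>x. (- \<delta>) * \<theta> x \<partial>lborel)"
    proof (rule integral_mono)
      show "integrable lborel (\<lambda>x. \<theta> x * ?I x)"
        by (rule integrable_truncated_potential[OF p \<sigma>(1) \<tau>(1) m KK cont \<theta>(2,3)])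
      show "\<theta> x * ?I x \<le> (- \<delta>) * \<theta> x" for x
      proof (cases "0 < \<theta> x")
        case True
        then show ?thesis
          using mult_left_mono[OF neg[OF True \<tau>(1) \<tau>(2)] nn[of x]] by (simp add: mult.commute)
      next
        case False
        then have "\<theta> x = 0" using nn[of x] by linarith
        then show ?thesis by simp
      qed
    qed (use int\<theta> in auto)
    moreover have "(\<integral>z. truncated_form p \<sigma> (\<tau> k) ?m \<theta> z \<partial>(lborel \<Otimes>\<^sub>M lborel)) = 2 * (\<integral>x. \<theta> x * ?I x \<partial>lborel)"
      by (rule integral_truncated_form[OF p \<sigma>(1) \<tau>(1) m KK cont \<theta>(2,3)])
    ultimately show ?thesis by simp
  qed
  have "(\<integral>z. energy_form p \<sigma> ?m \<theta> z \<partial>(lborel \<Otimes>\<^sub>M lborel)) \<le> - (2 * \<delta> * (\<integral>x. \<theta> x \<partial>lborel))"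
    by (rule LIMSEQ_le_const2[OF truncated_form_tendsto[OF p \<sigma> m \<theta> KK K(2) \<tau>0]]) (use le in auto)
  with ge have "\<delta> * (\<integral>x. \<theta> x \<partial>lborel) \<le> 0" by linarith
  then have "(\<integral>x. \<theta> x \<partial>lborel) \<le> 0" using \<delta> by (simp add: mult_le_0_iff)
  moreover have "0 \<le> (\<integral>x. \<theta> x \<partial>lborel)" using nn by (intro integral_nonneg_AE) auto
  ultimately show ?thesis
    using integral_eq_0_continuous_imp_zero[OF cont int\<theta> nn] by simp
qed

subsection \<open>Touching from below\<close>

text \<open>The integral is unchanged by z -> - z, so it is half that of the symmetrised integrand,
  to which \<open>J_add_sum_le\<close> applies with \<open>d = N * (norm z)\<^sup>2\<close> and
  \<open>a = \<xi> \<bullet> z\<close>. The bound is independent of the inner radius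
  \<open>\<tau>\<close>.\<close>

lemma near_part_le:
  fixes \<xi> :: "'a::euclidean_space"
  assumes p: "1 < p" "p < 2" and \<sigma>: "p - 1 < \<sigma>" and r: "0 < r" and N: "0 \<le> N" and \<tau>: "0 < \<tau>"
    and \<xi>: "\<xi> \<noteq> 0" and D: "0 \<le> D"
    and kernel: "(\<integral>\<^sup>+z. ennreal (\<bar>\<xi> \<bullet> z\<bar> powr (p - 2) * norm z powr (2 - real DIM('a) - \<sigma>)) * indicator {z. norm z < r} z \<partial>lborel)
      \<le> ennreal D"
  shows "integrable lborel (\<lambda>z. indicator {z. \<tau> < norm z \<and> norm z < r} z *
      (J p (N * (norm z)\<^sup>2 - \<xi> \<bullet> z) / norm z powr (real DIM('a) + \<sigma>)))" (is ?int)
    and "(\<integral>z. indicator {z. \<tau> < norm z \<and> norm z < r} z *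
      (J p (N * (norm z)\<^sup>2 - \<xi> \<bullet> z) / norm z powr (real DIM('a) + \<sigma>)) \<partial>lborel) \<le> 3 * N * D"
proof -
  let ?d = "real DIM('a) + \<sigma>"
  let ?A = "{z::'a. \<tau> < norm z \<and> norm z < r}"
  define F where "F z = indicator ?A z * (J p (N * (norm z)\<^sup>2 - \<xi> \<bullet> z) / norm z powr ?d)" for z
  define k where "k z = \<bar>\<xi> \<bullet> z\<bar> powr (p - 2) * norm z powr (2 - ?d)" for z
  have [measurable]: "k \<in> borel_measurable borel" unfolding k_def by measurable
  have [measurable]: "F \<in> borel_measurable borel" unfolding F_def by measurable
  have F: "integrable lborel F" unfolding F_def
  proof (rule integrable_J_quotient[OF p(1) \<sigma> \<tau>])
    show "\<bar>N * (norm z)\<^sup>2 - \<xi> \<bullet> z\<bar> \<le> (N * r + norm \<xi>) * norm z" if "z \<in> ?A" for z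
    proof -
      have "\<bar>N * (norm z)\<^sup>2 - \<xi> \<bullet> z\<bar> \<le> N * (norm z)\<^sup>2 + \<bar>\<xi> \<bullet> z\<bar>"
        using abs_triangle_ineq4[of "N * (norm z)\<^sup>2" "\<xi> \<bullet> z"] N by (simp add: abs_mult)
      also have "\<dots> \<le> N * (r * norm z) + norm \<xi> * norm z"
        using that N by (intro add_mono Cauchy_Schwarz_ineq2 mult_left_mono) (auto simp: power2_eq_square mult_right_mono)
      finally show ?thesis by (simp add: algebra_simps)
    qed
  qed (use N r in auto)
  then show ?int by (simp add: F_def[abs_def])
  have kint: "integrable lborel (\<lambda>z. indicator {z. norm z < r} z * k z)"
    and kle: "(\<integral>z. indicator {z. norm z < r} z * k z \<partial>lborel) \<le> D"
  proof -
    have nn: "(\<integral>\<^sup>+z. ennreal (k z) * indicator {z. norm z < r} z \<partial>lborel) \<le> ennreal D"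
      using kernel by (simp add: k_def diff_diff_eq)
    have "(\<integral>\<^sup>+z. ennreal (k z) * indicator {z. norm z < r} z \<partial>lborel) < \<infinity>"
      by (rule le_less_trans[OF nn]) simp
    then show i: "integrable lborel (\<lambda>z. indicator {z. norm z < r} z * k z)"
      by (intro integrable_lborel_indicatorI) (auto simp: k_def)
    have "ennreal (\<integral>z. indicator {z. norm z < r} z * k z \<partial>lborel) = (\<integral>\<^sup>+z. ennreal (indicator {z. norm z < r} z * k z) \<partial>lborel)"
      by (rule nn_integral_eq_integral[OF i, symmetric]) (auto simp: k_def)
    also have "\<dots> = (\<integral>\<^sup>+z. ennreal (k z) * indicator {z. norm z < r} z \<partial>lborel)"
      by (intro nn_integral_cong) (simp split: split_indicator)
    finally have "ennreal (\<integral>z. indicator {z. norm z < r} z * k z \<partial>lborel) \<le> ennreal D" using nn by simp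
    then show "(\<integral>z. indicator {z. norm z < r} z * k z \<partial>lborel) \<le> D"
      using D by (simp add: ennreal_le_iff)
  qed
  have Fm: "integrable lborel (\<lambda>z. F (- z))" "(\<integral>z. F (- z) \<partial>lborel) = (\<integral>z. F z \<partial>lborel)"
    using F integrable_lborel_reflect[of F 0] integral_lborel_reflect[of F 0] by auto
  \<comment> \<open>\<open>J_add_sum_le\<close> fails on this hyperplane, which has measure
    zero.\<close>
  have "negligible {z. \<xi> \<bullet> z = 0}" using \<xi> by (intro negligible_hyperplane) auto
  then have "AE z in lebesgue. \<xi> \<bullet> z \<noteq> 0"
    using AE_iff_null_sets[of "{z. \<xi> \<bullet> z = 0}" lebesgue] by (simp add: negligible_iff_null_sets null_setsD2)
  then have AE: "AE z in lborel. \<xi> \<bullet> z \<noteq> 0" by (simp add: AE_completion_iff)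
  have "(\<integral>z. F z + F (- z) \<partial>lborel) \<le> (\<integral>z. 3 * N * (indicator {z. norm z < r} z * k z) \<partial>lborel)"
  proof (rule integral_mono_AE)
    show "AE z in lborel. F z + F (- z) \<le> 3 * N * (indicator {z. norm z < r} z * k z)"
      using AE
    proof eventually_elim
      case (elim z)
      show ?case
      proof (cases "z \<in> ?A")
        case True
        then have z: "0 < norm z" using \<tau> by auto
        have "J p (N * (norm z)\<^sup>2 - \<xi> \<bullet> z) + J p (N * (norm z)\<^sup>2 + \<xi> \<bullet> z) \<le> 3 * (N * (norm z)\<^sup>2) * \<bar>\<xi> \<bullet> z\<bar> powr (p - 2)"
          using J_add_sum_le[OF p elim, of "N * (norm z)\<^sup>2"] N by (simp add: add.commute)
        then have "(J p (N * (norm z)\<^sup>2 - \<xi> \<bullet> z) + J p (N * (norm z)\<^sup>2 + \<xi> \<bullet> z)) / norm z powr ?d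
            \<le> 3 * (N * (norm z)\<^sup>2) * \<bar>\<xi> \<bullet> z\<bar> powr (p - 2) / norm z powr ?d"
          by (intro divide_right_mono) auto
        also have "\<dots> = 3 * N * k z"
          using z by (simp add: k_def powr_diff powr_numeral)
        finally show ?thesis using True by (simp add: F_def add_divide_distrib)
      next
        case False
        then have "F z = 0" "F (- z) = 0" by (auto simp: F_def)
        then show ?thesis using N by (simp add: k_def)
      qed
    qed
  qed (use F Fm kint in auto)
  also have "\<dots> \<le> 3 * N * D" using kle N by (simp add: mult_left_mono)
  finally have "2 * (\<integral>z. F z \<partial>lborel) \<le> 3 * N * D" using F Fm by simp
  moreover have "0 \<le> 3 * N * D" using N D by simp
  ultimately have "(\<integral>z. F z \<partial>lborel) \<le> 3 * N * D" by linarith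
  then show "(\<integral>z. indicator {z. \<tau> < norm z \<and> norm z < r} z *
      (J p (N * (norm z)\<^sup>2 - \<xi> \<bullet> z) / norm z powr ?d) \<partial>lborel) \<le> 3 * N * D"
    by (simp add: F_def)
qed

text \<open>A paraboloid is Lipschitz only on bounded sets, but the truncated difference vanishes at
  distance 1 or more from \<open>x0\<close>. Within distance 2 the slope of \<open>v\<close> is at
  most |\<xi>| + 4 N. If one point is farther away, either both values are 0, or the points are at
  least 1 apart while the values differ by at most 1.\<close>

lemma touching_function_lipschitz:
  fixes U :: "'a::euclidean_space \<Rightarrow> real"
  assumes U: "\<And>x y. \<bar>U x - U y\<bar> \<le> K * norm (x - y)" and K: "0 \<le> K"
    and N: "1 \<le> N" and t: "0 < t" "t \<le> 1"
    and touch: "\<And>x. v x - U x \<le> t\<^sup>2 - (norm (x - x0))\<^sup>2"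
    and v: "\<And>x. v x = c + \<xi> \<bullet> (x - x0) - N * (norm (x - x0))\<^sup>2"
  shows "\<bar>max 0 (v x - U x) - max 0 (v y - U y)\<bar> \<le> (norm \<xi> + 4 * N + K) * norm (x - y)"
proof -
  let ?K = "norm \<xi> + 4 * N + K"
  let ?\<theta> = "\<lambda>x. max 0 (v x - U x)"
  have far: "?\<theta> x = 0" if "1 \<le> norm (x - x0)" for x
  proof -
    have "t\<^sup>2 \<le> 1\<^sup>2" using t by (intro power_mono) auto
    also have "\<dots> \<le> (norm (x - x0))\<^sup>2" using that by (intro power_mono) auto
    finally show ?thesis using touch[of x] by simp
  qed
  have small: "?\<theta> x \<le> 1" for x
  proof -
    have "t\<^sup>2 \<le> 1" using t by (simp add: power_le_one)
    moreover have "0 \<le> (norm (x - x0))\<^sup>2" by simp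
    ultimately have "v x - U x \<le> 1" using touch[of x] by linarith
    then show ?thesis by simp
  qed
  have K1: "1 \<le> ?K" using N K norm_ge_zero[of \<xi>] by linarith
  have one: "\<bar>?\<theta> x - ?\<theta> y\<bar> \<le> ?K * norm (x - y)" if "2 \<le> norm (y - x0)" for x y
  proof (cases "norm (x - x0) < 1")
    case True
    then have "1 \<le> norm (x - y)"
      using that norm_triangle_ineq[of "y - x" "x - x0"] by (simp add: norm_minus_commute)
    then have "1 * 1 \<le> ?K * norm (x - y)" using K1 by (intro mult_mono) auto
    moreover have "\<bar>?\<theta> x - ?\<theta> y\<bar> \<le> 1" using far[of y] that small[of x] by (simp add: abs_if)
    ultimately show ?thesis by linarith
  next
    case False
    then show ?thesis using far[of x] far[of y] that K1 by simp
  qed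
  have two: "\<bar>?\<theta> x - ?\<theta> y\<bar> \<le> ?K * norm (x - y)" if "norm (x - x0) \<le> 2" "norm (y - x0) \<le> 2"
  proof -
    have "\<bar>(norm (x - x0))\<^sup>2 - (norm (y - x0))\<^sup>2\<bar> = \<bar>(x - y) \<bullet> ((x - x0) + (y - x0))\<bar>"
      by (simp add: power2_norm_eq_inner inner_diff inner_add algebra_simps inner_commute)
    also have "\<dots> \<le> norm (x - y) * norm ((x - x0) + (y - x0))" by (rule Cauchy_Schwarz_ineq2)
    also have "\<dots> \<le> norm (x - y) * 4"
      using that norm_triangle_ineq[of "x - x0" "y - x0"] by (intro mult_left_mono) auto
    finally have "N * \<bar>(norm (x - x0))\<^sup>2 - (norm (y - x0))\<^sup>2\<bar> \<le> N * (norm (x - y) * 4)"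
      using N by (intro mult_left_mono) auto
    moreover have "\<bar>\<xi> \<bullet> (x - y)\<bar> \<le> norm \<xi> * norm (x - y)" by (rule Cauchy_Schwarz_ineq2)
    moreover have "v x - v y = \<xi> \<bullet> (x - y) - N * ((norm (x - x0))\<^sup>2 - (norm (y - x0))\<^sup>2)"
      by (simp add: v inner_diff algebra_simps)
    then have "\<bar>v x - v y\<bar> \<le> \<bar>\<xi> \<bullet> (x - y)\<bar> + N * \<bar>(norm (x - x0))\<^sup>2 - (norm (y - x0))\<^sup>2\<bar>"
      using N abs_triangle_ineq4[of "\<xi> \<bullet> (x - y)" "N * ((norm (x - x0))\<^sup>2 - (norm (y - x0))\<^sup>2)"]
      by (simp add: abs_mult)
    ultimately have "\<bar>v x - v y\<bar> + \<bar>U x - U y\<bar> \<le> ?K * norm (x - y)"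
      using U[of x y] by (simp add: algebra_simps)
    then show ?thesis by (auto simp: max_def abs_if split: if_splits)
  qed
  show ?thesis
    using one[of y x] one[of x y] two
    by (cases "2 \<le> norm (y - x0)"; cases "2 \<le> norm (x - x0)") (auto simp: norm_minus_commute abs_minus_commute)
qed

text \<open>A weak solution touched from below by a paraboloid of nonzero slope is a supersolution at the
  touching point: otherwise lifting the (slightly steeper) paraboloid by \<open>t\<^sup>2\<close> contradicts
  \<open>weak_comparison\<close>. The nonzero slope makes the singular kernel bound applicable near the point.\<close>

lemma touching_from_below:
  fixes U :: "'a::euclidean_space \<Rightarrow> real"
  assumes p: "1 < p" "p < 2" and \<sigma>: "p - 1 < \<sigma>" "\<sigma> < p"
    and weak: "\<And>\<phi>. \<phi> \<in> test_functions \<Longrightarrow> (\<integral>z. energy_form p \<sigma> U \<phi> z \<partial>(lborel \<Otimes>\<^sub>M lborel)) = 0"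
    and U: "\<And>x y. \<bar>U x - U y\<bar> \<le> K * norm (x - y)" and K: "0 \<le> K"
    and \<xi>: "\<xi> \<noteq> 0" and M: "0 \<le> M"
    and touch: "\<And>x. U x0 + \<xi> \<bullet> (x - x0) - M * (norm (x - x0))\<^sup>2 \<le> U x"
  obtains C where "0 \<le> C" "\<And>r. 0 < r \<Longrightarrow>
      - C * r powr (p - \<sigma>) \<le> (\<integral>z. indicator {z. r \<le> norm z} z * jump_quotient p \<sigma> U x0 z \<partial>lborel)"
proof -
  let ?d = "real DIM('a) + \<sigma>"
  \<comment> \<open>The additional unit of curvature gives
    \<open>v x - U x \<le> t\<^sup>2 - (norm (x - x0))\<^sup>2\<close> after lifting by t^2, which
    confines the test function to the ball of radius t.\<close>
  define N where "N = M + 1"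
  have N: "1 \<le> N" using M by (simp add: N_def)
  \<comment> \<open>Half of |\<xi>| leaves room for the slopes at points near \<open>x0\<close>:
    they differ from \<open>\<xi>\<close> by at most 2 N t, and \<open>t\<close> will be below
    |\<xi>| / (4 N).\<close>
  obtain D where D: "0 \<le> D" "\<And>(\<zeta>::'a) r. norm \<xi> / 2 \<le> norm \<zeta> \<Longrightarrow> 0 < r \<Longrightarrow>
      (\<integral>\<^sup>+z. ennreal (\<bar>\<zeta> \<bullet> z\<bar> powr (p - 2) * norm z powr (2 - real DIM('a) - \<sigma>)) * indicator {z. norm z < r} z \<partial>lborel)
      \<le> ennreal (D * r powr (p - \<sigma>))"
    using singular_kernel_bound[OF p \<sigma>(2), of "norm \<xi> / 2", where 'a='a] \<xi> by auto
  have [measurable]: "U \<in> borel_measurable borel"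
    by (rule borel_measurable_continuous_onI[OF lipschitz_continuous[OF U]])
  have main: "- (3 * N * D) * r powr (p - \<sigma>) \<le> (\<integral>z. indicator {z. r \<le> norm z} z * jump_quotient p \<sigma> U x0 z \<partial>lborel)"
    if r: "0 < r" for r
  proof (rule ccontr)
    define E where "E = (\<integral>z. indicator {z. r \<le> norm z} z * jump_quotient p \<sigma> U x0 z \<partial>lborel)"
    define T where "T = (\<integral>z. indicator {z::'a. r \<le> norm z} z * norm z powr (- ?d) \<partial>lborel)"
    have Tint: "integrable lborel (\<lambda>z. indicator {z::'a. r \<le> norm z} z * norm z powr (- ?d))"
      using p \<sigma> r by (intro integrable_norm_powr_outside) auto
    \<comment> \<open>Half of the deficit: the near part and \<open>E\<close> add up to at most -2
      \<delta>, and the shift error will consume at most one \<delta>.\<close>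
    define \<delta> where "\<delta> = - (3 * N * D * r powr (p - \<sigma>) + E) / 2"
    assume "\<not> - (3 * N * D) * r powr (p - \<sigma>) \<le> (\<integral>z. indicator {z. r \<le> norm z} z * jump_quotient p \<sigma> U x0 z \<partial>lborel)"
    then have \<delta>: "0 < \<delta>" by (simp add: \<delta>_def E_def)
    \<comment> \<open>Bounds the error of replacing \<open>x\<close> by \<open>x0\<close> in the far
      increments: |\<xi>| t from the linear term, t^2 <= t from the lift, and K t from moving
      \<open>U\<close>.\<close>
    define \<omega> where "\<omega> t = (norm \<xi> + 1 + K) * t" for t
    have \<omega>: "0 \<le> \<omega> t" if "0 < t" for t using that K by (simp add: \<omega>_def)
    have "(\<omega> \<longlongrightarrow> 0) (at_right 0)"
      unfolding \<omega>_def[abs_def] by (intro tendsto_mult_right_zero tendsto_ident_at)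
    then have "((\<lambda>t. \<omega> t powr (p - 1)) \<longlongrightarrow> 0) (at_right 0)"
      by (rule tendsto_zero_powrI[OF _ tendsto_const])
         (use p \<omega> in \<open>auto simp: eventually_at_filter\<close>)
    then have "((\<lambda>t. \<omega> t powr (p - 1) * (2 * T)) \<longlongrightarrow> 0) (at_right 0)"
      by (rule tendsto_mult_left_zero)
    then have "\<forall>\<^sub>F t in at_right 0. \<omega> t powr (p - 1) * (2 * T) < \<delta>"
      using \<delta> by (rule order_tendstoD(2))
    moreover have "\<forall>\<^sub>F t in at_right 0. t < min 1 (norm \<xi> / (4 * N))"
      using \<xi> N by (intro order_tendstoD(2)[OF tendsto_ident_at]) auto
    moreover have "\<forall>\<^sub>F t::real in at_right 0. 0 < t" by (rule eventually_at_right_less)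
    ultimately have "\<forall>\<^sub>F t in at_right 0. 0 < t \<and> t < min 1 (norm \<xi> / (4 * N)) \<and> \<omega> t powr (p - 1) * (2 * T) < \<delta>"
      by eventually_elim auto
    then obtain t where t: "0 < t" "t < min 1 (norm \<xi> / (4 * N))" "\<omega> t powr (p - 1) * (2 * T) < \<delta>"
      using eventually_happens'[OF trivial_limit_at_right_real] by blast
    have t1: "t \<le> 1" and tN: "2 * N * t \<le> norm \<xi> / 2"
      using t N by (auto simp: field_simps)
    define v where "v x = (U x0 + t\<^sup>2) + \<xi> \<bullet> (x - x0) - N * (norm (x - x0))\<^sup>2" for x
    define \<theta> where "\<theta> x = max 0 (v x - U x)" for x
    have vU: "v x - U x \<le> t\<^sup>2 - (norm (x - x0))\<^sup>2" for x
      using touch[of x] by (simp add: v_def N_def algebra_simps)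
    have lip: "\<bar>\<theta> x - \<theta> y\<bar> \<le> (norm \<xi> + 4 * N + K) * norm (x - y)" for x y
      unfolding \<theta>_def by (rule touching_function_lipschitz[OF U K N t(1) t1 vU v_def])
    have supp: "norm (x - x0) \<le> t" if "\<theta> x \<noteq> 0" for x
    proof -
      have "0 < v x - U x" using that by (auto simp: \<theta>_def max_def split: if_splits)
      then have "(norm (x - x0))\<^sup>2 \<le> t\<^sup>2" using vU[of x] by linarith
      then show ?thesis by (rule power2_le_imp_le) (use t in simp)
    qed
    have "\<theta> x0 = 0"
    proof (rule weak_comparison[OF p(1) \<sigma> weak U lip _ _ K, of 1 "norm x0 + 1" \<delta> r])
      show "\<bar>\<theta> x\<bar> \<le> 1" for x
      proof -
        have "t\<^sup>2 \<le> 1" using t by (simp add: power_le_one)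
        moreover have "0 \<le> (norm (x - x0))\<^sup>2" by simp
        ultimately have "v x - U x \<le> 1" using vU[of x] by linarith
        then show ?thesis by (simp add: \<theta>_def)
      qed
      show "\<theta> x = 0" if "norm x0 + 1 < norm x" for x
        using supp[of x] that t1 norm_triangle_ineq2[of x x0] by linarith
    next
      fix x \<tau> assume x: "0 < \<theta> x" and \<tau>: "0 < \<tau>" "\<tau> < r"
      let ?m = "\<lambda>x. U x + \<theta> x"
      have m: "\<bar>?m x - ?m y\<bar> \<le> (K + (norm \<xi> + 4 * N + K)) * norm (x - y)" for x y
        using U[of x y] lip[of x y] by (simp add: distrib_right)
      have mint: "integrable lborel (\<lambda>z. indicator {z. \<tau> < norm z} z * jump_quotient p \<sigma> ?m x z)"
        using K N by (intro integrable_jump_quotient'[OF p(1) \<sigma>(1) \<tau>(1) m]) auto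
      have mx: "?m x = v x" and mv: "v y \<le> ?m y" and mU: "U y \<le> ?m y" for y
        using x by (auto simp: \<theta>_def)
      have xt: "norm (x - x0) \<le> t" using supp x by simp
      \<comment> \<open>The gradient of \<open>v\<close> at \<open>x\<close>; expanding the
        quadratic there is exact, which gives \<open>vdiff\<close>.\<close>
      define \<zeta> where "\<zeta> = \<xi> - (2 * N) *\<^sub>R (x - x0)"
      have "norm ((2 * N) *\<^sub>R (x - x0)) \<le> 2 * N * t" using xt N by simp
      then have \<zeta>: "norm \<xi> / 2 \<le> norm \<zeta>"
        using tN norm_triangle_ineq2[of \<xi> "(2 * N) *\<^sub>R (x - x0)"] by (simp add: \<zeta>_def)
      then have \<zeta>0: "\<zeta> \<noteq> 0" using \<xi> by auto
      have vdiff: "v x - v (x + z) = N * (norm z)\<^sup>2 - \<zeta> \<bullet> z" for z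
        by (simp add: v_def \<zeta>_def power2_norm_eq_inner inner_diff inner_add algebra_simps inner_commute)
      let ?near = "\<lambda>z. indicator {z. \<tau> < norm z \<and> norm z < r} z * (J p (N * (norm z)\<^sup>2 - \<zeta> \<bullet> z) / norm z powr ?d)"
      have near: "integrable lborel ?near" "(\<integral>z. ?near z \<partial>lborel) \<le> 3 * N * (D * r powr (p - \<sigma>))"
        using near_part_le[OF p \<sigma>(1) r _ \<tau>(1) \<zeta>0 _ D(2)[OF \<zeta> r], of N] N D(1) by auto
      let ?far = "\<lambda>z. indicator {z. r \<le> norm z} z * jump_quotient p \<sigma> U x0 z"
      have far: "integrable lborel ?far" by (rule integrable_jump_quotient[OF p(1) \<sigma>(1) r U K])
      let ?err = "\<lambda>z::'a. 2 * \<omega> t powr (p - 1) * (indicator {z. r \<le> norm z} z * norm z powr (- ?d))"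
      have \<omega>0: "0 \<le> \<omega> t" using t K by (simp add: \<omega>_def)
      have shift: "v x - U (x + z) \<le> U x0 - U (x0 + z) + \<omega> t" for z
      proof -
        have "\<xi> \<bullet> (x - x0) \<le> norm \<xi> * t"
          using norm_cauchy_schwarz[of \<xi> "x - x0"] mult_left_mono[OF xt norm_ge_zero[of \<xi>]] by linarith
        moreover have "t\<^sup>2 \<le> t" using t t1 by (simp add: power2_eq_square mult_left_le)
        moreover have "0 \<le> N * (norm (x - x0))\<^sup>2" using N by simp
        moreover have "U (x0 + z) - U (x + z) \<le> K * t"
          using U[of "x0 + z" "x + z"] mult_left_mono[OF xt K] by (simp add: norm_minus_commute)
        ultimately show ?thesis by (simp add: v_def \<omega>_def algebra_simps)
      qed
      have "(\<integral>z. indicator {z. \<tau> < norm z} z * jump_quotient p \<sigma> ?m x z \<partial>lborel) \<le> (\<integral>z. ?near z + (?far z + ?err z) \<partial>lborel)"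
      proof (rule integral_mono)
        fix z :: 'a
        \<comment> \<open>The maximum of \<open>U\<close> and \<open>v\<close> equals
          \<open>v\<close> at \<open>x\<close> and lies above both functions elsewhere. Close to
          \<open>x\<close> it is compared with \<open>v\<close>, where the paraboloid estimate
          applies; beyond \<open>r\<close> with \<open>U\<close>, where the Hoelder bound for
          \<open>J p\<close> absorbs the shift.\<close>
        consider "norm z \<le> \<tau>" | "\<tau> < norm z" "norm z < r" | "r \<le> norm z" by linarith
        then show "indicator {z. \<tau> < norm z} z * jump_quotient p \<sigma> ?m x z \<le> ?near z + (?far z + ?err z)"
        proof cases
          case 1
          then show ?thesis using \<tau> by simp
        next
          case 2
          have "J p (?m x - ?m (x + z)) \<le> J p (N * (norm z)\<^sup>2 - \<zeta> \<bullet> z)"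
            unfolding vdiff[symmetric] using mx mv[of "x + z"] by (intro J_mono[OF p(1)]) linarith
          then show ?thesis using 2 by (simp add: jump_quotient_def divide_right_mono)
        next
          case 3
          have "J p (?m x - ?m (x + z)) \<le> J p (U x0 - U (x0 + z) + \<omega> t)"
            using mx mU[of "x + z"] shift[of z] by (intro J_mono[OF p(1)]) linarith
          also have "\<dots> \<le> J p (U x0 - U (x0 + z)) + 2 * \<omega> t powr (p - 1)"
            using J_add_diff_le[OF p \<omega>0, of "U x0 - U (x0 + z)"] by linarith
          finally have "J p (?m x - ?m (x + z)) / norm z powr ?d \<le> (J p (U x0 - U (x0 + z)) + 2 * \<omega> t powr (p - 1)) / norm z powr ?d"
            by (rule divide_right_mono) simp
          then show ?thesis using 3 \<tau> unfolding powr_minus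
            by (simp add: jump_quotient_def distrib_right divide_inverse)
        qed
      qed (use mint near far Tint in auto)
      also have "\<dots> = (\<integral>z. ?near z \<partial>lborel) + (E + 2 * \<omega> t powr (p - 1) * T)"
        using near(1) far Tint unfolding E_def T_def
        by (subst Bochner_Integration.integral_add, simp, simp, subst Bochner_Integration.integral_add) auto
      also have "\<dots> \<le> 3 * N * (D * r powr (p - \<sigma>)) + E + \<delta>" using near(2) t(3) by (simp add: mult_ac)
      also have "\<dots> = - \<delta>" by (simp add: \<delta>_def field_simps)
      finally show "(\<integral>z. indicator {z. \<tau> < norm z} z * jump_quotient p \<sigma> ?m x z \<partial>lborel) \<le> - \<delta>" .
    qed (use N K \<delta> r in \<open>auto simp: \<theta>_def\<close>)
    moreover have "\<theta> x0 = t\<^sup>2" by (simp add: \<theta>_def v_def)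
    ultimately show False using t by simp
  qed
  show thesis using that[of "3 * N * D"] main N D(1) by simp
qed

subsection \<open>Extremal segments\<close>

text \<open>This is 2 |c| |c + w| <= |c|^2 + |c + w|^2 divided by 2 |c|, valid for all
  \<open>w\<close> without any smallness.\<close>

lemma norm_add_le_second_order:
  fixes c w :: "'a::real_inner"
  assumes "c \<noteq> 0"
  shows "norm (c + w) \<le> norm c + (c \<bullet> w) / norm c + (norm w)\<^sup>2 / (2 * norm c)"
proof -
  have c: "0 < norm c" using assms by simp
  have "0 \<le> (norm c - norm (c + w))\<^sup>2" by simp
  then have "2 * norm c * norm (c + w) \<le> (norm c)\<^sup>2 + (norm (c + w))\<^sup>2"
    by (simp add: power2_diff)
  also have "\<dots> = 2 * (norm c)\<^sup>2 + 2 * (c \<bullet> w) + (norm w)\<^sup>2"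
    by (simp add: power2_norm_eq_inner inner_add inner_commute)
  also have "\<dots> = 2 * norm c * (norm c + (c \<bullet> w) / norm c + (norm w)\<^sup>2 / (2 * norm c))"
    using c by (simp add: field_simps power2_eq_square)
  finally show ?thesis by (rule mult_left_le_imp_le) (use c in simp)
qed

text \<open>The cone x -> U b - L |b - x| lies below \<open>U\<close> and meets it at
  \<open>x0\<close>. Away from its vertex the norm admits the global quadratic bound above, so a
  paraboloid of slope L fits below the cone.\<close>

lemma extremal_cone_touches:
  fixes U :: "'a::real_inner \<Rightarrow> real"
  assumes U: "\<And>x y. \<bar>U x - U y\<bar> \<le> L * norm (x - y)" and L: "0 \<le> L" and ne: "b \<noteq> x0"
    and eq: "U b - U x0 = L * norm (b - x0)"
  shows "U x0 + ((L / norm (b - x0)) *\<^sub>R (b - x0)) \<bullet> (x - x0) - L / (2 * norm (b - x0)) * (norm (x - x0))\<^sup>2 \<le> U x"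
proof -
  have "U b - L * norm (b - x) \<le> U x" using U[of b x] by linarith
  moreover have "L * norm (b - x) \<le> L * (norm (b - x0) - ((b - x0) \<bullet> (x - x0)) / norm (b - x0) + (norm (x - x0))\<^sup>2 / (2 * norm (b - x0)))"
    using norm_add_le_second_order[of "b - x0" "x0 - x"] ne L
    by (intro mult_left_mono) (auto simp: norm_minus_commute[of x x0] inner_diff_right diff_divide_distrib)
  ultimately show ?thesis
    unfolding inner_scaleR_left using eq by (simp add: distrib_left right_diff_distrib)
qed

text \<open>Comparing \<open>y\<close> with \<open>x\<close> translated k times, the terms linear in
  k cancel, and expanding |k h + (x - y)| leaves the inner product with h / |h| and an error of
  order 1 / k. The limit is a one-sided inequality; exchanging the points gives equality.\<close>

lemma affine_if_extremal_translation:
  fixes U :: "'a::real_inner \<Rightarrow> real"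
  assumes U: "\<And>x y. \<bar>U x - U y\<bar> \<le> L * norm (x - y)" and L: "0 \<le> L" and h: "h \<noteq> 0"
    and shift: "\<And>x. U (x + h) = U x + L * norm h"
  shows "U x = ((L / norm h) *\<^sub>R h) \<bullet> x + U 0"
proof -
  have iter: "U (x + real n *\<^sub>R h) = U x + real n * (L * norm h)" for x n
  proof (induction n)
    case (Suc n)
    have "x + real (Suc n) *\<^sub>R h = (x + real n *\<^sub>R h) + h" by (simp add: algebra_simps)
    then show ?case using Suc shift[of "x + real n *\<^sub>R h"] by (simp add: algebra_simps)
  qed simp
  have le: "U x - U y \<le> L * ((h \<bullet> (x - y)) / norm h)" for x y
  proof (rule LIMSEQ_le_const)
    let ?c = "L * (norm (x - y))\<^sup>2 / (2 * norm h)"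
    have "(\<lambda>n. L * ((h \<bullet> (x - y)) / norm h) + ?c * (1 / real (Suc n))) \<longlonglongrightarrow> L * ((h \<bullet> (x - y)) / norm h) + ?c * 0"
      by (intro tendsto_intros LIMSEQ_Suc[OF lim_1_over_n])
    then show "(\<lambda>n. L * ((h \<bullet> (x - y)) / norm h) + ?c * (1 / real (Suc n))) \<longlonglongrightarrow> L * ((h \<bullet> (x - y)) / norm h)"
      by simp
    have "U x - U y \<le> L * ((h \<bullet> (x - y)) / norm h) + ?c * (1 / real (Suc n))" for n
    proof -
      let ?k = "real (Suc n)"
      have k: "0 < ?k" by simp
      have "U (x + ?k *\<^sub>R h) - U y \<le> L * norm (?k *\<^sub>R h + (x - y))"
        using U[of "x + ?k *\<^sub>R h" y] by (simp add: algebra_simps)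
      also have "\<dots> \<le> L * (?k * norm h + (h \<bullet> (x - y)) / norm h + (norm (x - y))\<^sup>2 / (2 * (?k * norm h)))"
        using norm_add_le_second_order[of "?k *\<^sub>R h" "x - y"] h k L
        by (intro mult_left_mono) (auto simp del: of_nat_Suc)
      also have "\<dots> = ?k * (L * norm h) + L * ((h \<bullet> (x - y)) / norm h) + ?c * (1 / ?k)"
        by (simp add: distrib_left del: of_nat_Suc)
      finally show ?thesis using iter[of x "Suc n"] by linarith
    qed
    then show "\<exists>N. \<forall>n\<ge>N. U x - U y \<le> L * ((h \<bullet> (x - y)) / norm h) + ?c * (1 / real (Suc n))" by blast
  qed
  have "U x - U 0 = L * ((h \<bullet> x) / norm h)"
    using le[of x 0] le[of 0 x] by simp
  then show ?thesis by simp
qed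

lemma jump_quotient_minus: "jump_quotient p \<sigma> (\<lambda>x. - u x) x z = - jump_quotient p \<sigma> u x z"
  using J_minus[of p "u x - u (x + z)"] by (simp add: jump_quotient_def)

lemma energy_form_minus: "energy_form p \<sigma> (\<lambda>x. - u x) \<theta> z = - energy_form p \<sigma> u \<theta> z"
  using J_minus[of p "u (fst z) - u (snd z)"] by (simp add: energy_form_def split_beta)

text \<open>Thirds keep \<open>x0\<close> away from \<open>b\<close> and \<open>x1\<close> away from
  \<open>a\<close>, the vertices of the cones used there, and make \<open>x1 - x0\<close> the
  translation vector.\<close>

lemma extremal_translation:
  fixes U :: "'a::euclidean_space \<Rightarrow> real"
  assumes p: "1 < p" "p < 2" and \<sigma>: "p - 1 < \<sigma>" "\<sigma> < p"
    and weak: "\<And>\<phi>. \<phi> \<in> test_functions \<Longrightarrow> (\<integral>z. energy_form p \<sigma> U \<phi> z \<partial>(lborel \<Otimes>\<^sub>M lborel)) = 0"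
    and U: "\<And>x y. \<bar>U x - U y\<bar> \<le> L * norm (x - y)" and L: "0 < L"
    and ne: "a \<noteq> b" and ext: "U b - U a = L * norm (b - a)"
  shows "U (x + (1 / 3) *\<^sub>R (b - a)) = U x + L * norm ((1 / 3) *\<^sub>R (b - a))"
proof -
  define x0 where "x0 = a + (1 / 3) *\<^sub>R (b - a)"
  define x1 where "x1 = a + (2 / 3) *\<^sub>R (b - a)"
  have L0: "0 \<le> L" using L by simp
  have d: "x0 - a = (1 / 3) *\<^sub>R (b - a)" "b - x0 = (2 / 3) *\<^sub>R (b - a)"
    "x1 - a = (2 / 3) *\<^sub>R (b - a)" "b - x1 = (1 / 3) *\<^sub>R (b - a)" "x1 - x0 = (1 / 3) *\<^sub>R (b - a)"
    by (auto intro!: euclidean_eqI[where 'a='a] simp: x0_def x1_def inner_simps field_simps)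
  \<comment> \<open>The Lipschitz bounds on two consecutive subsegments add up to the extremal
    increment, so each of them must be an equality.\<close>
  have val: "U x0 = U a + L * norm (b - a) / 3" "U x1 = U a + 2 * (L * norm (b - a)) / 3"
  proof -
    have "\<bar>U x0 - U a\<bar> \<le> L * norm (b - a) / 3" "\<bar>U b - U x0\<bar> \<le> 2 * (L * norm (b - a)) / 3"
      "\<bar>U x1 - U a\<bar> \<le> 2 * (L * norm (b - a)) / 3" "\<bar>U b - U x1\<bar> \<le> L * norm (b - a) / 3"
      using U[of x0 a] U[of b x0] U[of x1 a] U[of b x1] by (simp_all add: d)
    then show "U x0 = U a + L * norm (b - a) / 3" "U x1 = U a + 2 * (L * norm (b - a)) / 3"
      using ext by linarith+
  qed
  have n0: "b \<noteq> x0" and n1: "a \<noteq> x1"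
    using d ne by (metis eq_iff_diff_eq_0 scaleR_eq_0_iff zero_neq_numeral divide_eq_0_iff)+
  have ext0: "U b - U x0 = L * norm (b - x0)" using val ext by (simp add: d)
  have nz0: "(L / norm (b - x0)) *\<^sub>R (b - x0) \<noteq> 0" "0 \<le> L / (2 * norm (b - x0))" using L n0 by simp_all
  obtain C0 where C0: "0 \<le> C0" "\<And>r. 0 < r \<Longrightarrow>
      - C0 * r powr (p - \<sigma>) \<le> (\<integral>z. indicator {z. r \<le> norm z} z * jump_quotient p \<sigma> U x0 z \<partial>lborel)"
    using touching_from_below[OF p \<sigma> weak U L0 nz0 extremal_cone_touches[OF U L0 n0 ext0]] by blast
  have U': "\<bar>- U x - - U y\<bar> \<le> L * norm (x - y)" for x y using U[of y x] by (simp add: norm_minus_commute)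
  have ext1: "- U a - - U x1 = L * norm (a - x1)"
    using val d by (simp add: norm_minus_commute[of a x1])
  have weak': "(\<integral>z. energy_form p \<sigma> (\<lambda>x. - U x) \<phi> z \<partial>(lborel \<Otimes>\<^sub>M lborel)) = 0" if "\<phi> \<in> test_functions" for \<phi>
    using weak[OF that] by (simp add: energy_form_minus)
  have nz1: "(L / norm (a - x1)) *\<^sub>R (a - x1) \<noteq> 0" "0 \<le> L / (2 * norm (a - x1))" using L n1 by simp_all
  obtain C1 where C1: "0 \<le> C1" "\<And>r. 0 < r \<Longrightarrow>
      - C1 * r powr (p - \<sigma>) \<le> (\<integral>z. indicator {z. r \<le> norm z} z * jump_quotient p \<sigma> (\<lambda>x. - U x) x1 z \<partial>lborel)"
    using touching_from_below[OF p \<sigma> weak' U' L0 nz1 extremal_cone_touches[OF U' L0 n1 ext1]] by blast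
  define G where "G z = jump_quotient p \<sigma> U x1 z - jump_quotient p \<sigma> U x0 z" for z
  \<comment> \<open>The numerator of \<open>G\<close>; it is continuous on the whole space, so
    vanishing almost everywhere on an open set yields vanishing at each of its points.\<close>
  define g where "g z = J p (U x1 - U (x1 + z)) - J p (U x0 - U (x0 + z))" for z
  have Gg: "G z = g z / norm z powr (real DIM('a) + \<sigma>)" for z
    by (simp add: G_def g_def jump_quotient_def diff_divide_distrib)
  have G0: "0 \<le> G z" for z
  proof -
    have "U (x1 + z) - U (x0 + z) \<le> L * norm (b - a) / 3"
      using abs_le_D1[OF U[of "x1 + z" "x0 + z"]] by (simp add: d(5))
    then have "J p (U x0 - U (x0 + z)) \<le> J p (U x1 - U (x1 + z))"
      using val by (intro J_mono[OF p(1)]) linarith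
    then show ?thesis by (simp add: Gg g_def)
  qed
  have Gint: "integrable lborel (\<lambda>z. indicator {z. r \<le> norm z} z * G z)" if "0 < r" for r
    unfolding G_def right_diff_distrib
    by (intro Bochner_Integration.integrable_diff integrable_jump_quotient[OF p(1) \<sigma>(1) that U L0])
  have Gle: "(\<integral>z. indicator {z. r \<le> norm z} z * G z \<partial>lborel) \<le> (C0 + C1) * r powr (p - \<sigma>)" if "0 < r" for r
  proof -
    have "(\<integral>z. indicator {z. r \<le> norm z} z * G z \<partial>lborel) =
        (\<integral>z. indicator {z. r \<le> norm z} z * jump_quotient p \<sigma> U x1 z \<partial>lborel) -
        (\<integral>z. indicator {z. r \<le> norm z} z * jump_quotient p \<sigma> U x0 z \<partial>lborel)"
      unfolding G_def right_diff_distrib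
      by (intro Bochner_Integration.integral_diff integrable_jump_quotient[OF p(1) \<sigma>(1) that U L0])
    also have "\<dots> \<le> (C0 + C1) * r powr (p - \<sigma>)"
      using C0(2)[OF that] C1(2)[OF that] by (simp add: jump_quotient_minus algebra_simps)
    finally show ?thesis .
  qed
  \<comment> \<open>As \<open>G\<close> is nonnegative, its integral outside radius \<open>r\<close>
    is at most that outside any smaller radius \<open>t\<close>, hence at most
    \<open>(C0 + C1) * t powr (p - \<sigma>)\<close>, which tends to 0.\<close>
  have zero: "(\<integral>z. indicator {z. r \<le> norm z} z * G z \<partial>lborel) = 0" if r: "0 < r" for r
  proof (rule antisym)
    have lim: "((\<lambda>t. (C0 + C1) * t powr (p - \<sigma>)) \<longlongrightarrow> 0) (at_right 0)"
      using \<sigma> by (intro tendsto_mult_right_zero tendsto_zero_powrI[OF tendsto_ident_at tendsto_const])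
        (auto simp: eventually_at_filter)
    have "\<forall>\<^sub>F t::real in at_right 0. t < r" using r by (intro order_tendstoD(2)[OF tendsto_ident_at]) auto
    moreover have "\<forall>\<^sub>F t::real in at_right 0. 0 < t" by (rule eventually_at_right_less)
    ultimately have "\<forall>\<^sub>F t in at_right 0. (\<integral>z. indicator {z. r \<le> norm z} z * G z \<partial>lborel) \<le> (C0 + C1) * t powr (p - \<sigma>)"
    proof eventually_elim
      case (elim t)
      have "(\<integral>z. indicator {z. r \<le> norm z} z * G z \<partial>lborel) \<le> (\<integral>z. indicator {z. t \<le> norm z} z * G z \<partial>lborel)"
        using elim G0 by (intro integral_mono Gint r) (auto simp: indicator_def)
      also have "\<dots> \<le> (C0 + C1) * t powr (p - \<sigma>)" using elim by (intro Gle) auto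
      finally show ?case .
    qed
    then show "(\<integral>z. indicator {z. r \<le> norm z} z * G z \<partial>lborel) \<le> 0"
      by (rule tendsto_lowerbound[OF lim]) simp
    show "0 \<le> (\<integral>z. indicator {z. r \<le> norm z} z * G z \<partial>lborel)"
      using G0 by (intro integral_nonneg_AE) auto
  qed
  have contU: "continuous_on UNIV U" by (rule lipschitz_continuous[OF U])
  have contg: "continuous_on A g" for A
    unfolding g_def[abs_def]
    by (intro continuous_intros continuous_on_J p continuous_on_compose2[OF contU]) auto
  have g: "g z = 0" if z: "z \<noteq> 0" for z
  proof (rule AE_zero_open_imp_zero[where f = g and x = z and S = "{w. norm z / 2 < norm w}"])
    let ?r = "norm z / 2"
    have r: "0 < ?r" using z by simp
    have "AE w in lborel. indicator {z. ?r \<le> norm z} w * G w = 0"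
      using integral_nonneg_eq_0_iff_AE[OF Gint[OF r]] zero[OF r] G0 by simp
    then show "AE w in lborel. w \<in> {w. ?r < norm w} \<longrightarrow> g w = 0"
      by eventually_elim (auto simp: Gg)
    show "open {w. ?r < norm w}" by (intro open_Collect_less continuous_intros)
  qed (use contg z in auto)
  have shift: "U (x1 + z) = U (x0 + z) + L * norm (b - a) / 3" for z
  proof (cases "z = 0")
    case False
    then have "J p (U x1 - U (x1 + z)) = J p (U x0 - U (x0 + z))" using g[of z] by (simp add: g_def)
    then have "U x1 - U (x1 + z) = U x0 - U (x0 + z)"
      using strict_mono_eq[OF J_strict_mono[OF p(1)]] by blast
    then show ?thesis using val by linarith
  qed (use val in simp)
  have "U (x + (1 / 3) *\<^sub>R (b - a)) = U (x1 + (x - x0))"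
    unfolding d(5)[symmetric] by (rule arg_cong[where f = U]) simp
  then show ?thesis using shift[of "x - x0"] by simp
qed

lemma abs_diff_le_lipschitz_seminorm:
  assumes "globally_lipschitz U"
  shows "\<bar>U x - U y\<bar> \<le> lipschitz_seminorm U * norm (x - y)"
proof (cases "x = y")
  case False
  obtain C where C: "C-lipschitz_on UNIV U" using assms by (auto simp: globally_lipschitz_def)
  \<comment> \<open>A supremum in \<open>real\<close> is an upper bound only for bounded sets; the
    Lipschitz hypothesis provides this.\<close>
  have "bdd_above ((\<lambda>(x, y). \<bar>U x - U y\<bar> / norm (x - y)) ` {(x, y). x \<noteq> y})"
  proof (rule bdd_aboveI2)
    fix z :: "'a \<times> 'a" assume "z \<in> {(x, y). x \<noteq> y}"
    then show "(case z of (x, y) \<Rightarrow> \<bar>U x - U y\<bar> / norm (x - y)) \<le> C"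
      using lipschitz_onD[OF C] by (auto simp: dist_norm divide_le_eq)
  qed
  then have "\<bar>U x - U y\<bar> / norm (x - y) \<le> lipschitz_seminorm U"
    unfolding lipschitz_seminorm_def using cSUP_upper[of "(x, y)" "{(x, y). x \<noteq> y}"] False by fastforce
  then show ?thesis using False by (simp add: divide_le_eq)
qed simp

theorem theorem2p3:
  fixes U :: "real ^ 'n \<Rightarrow> real" and s p :: real and a b :: "real ^ 'n"
  assumes "CARD('n) \<ge> 2"
    and "0 < s" and "s < 1"
    and "1 < p" and "p < 2"
    and "s * p > p - 1"
    and "globally_lipschitz U"
    and "entire_weak_solution s p U"
    and "a \<noteq> b"
    and "\<bar>U b - U a\<bar> = lipschitz_seminorm U * norm (b - a)"
  shows "\<exists>\<xi> c. \<forall>x. U x = \<xi> \<bullet> x + c"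
proof -
  define L where "L = lipschitz_seminorm U"
  have U: "\<bar>U x - U y\<bar> \<le> L * norm (x - y)" for x y
    unfolding L_def by (rule abs_diff_le_lipschitz_seminorm[OF assms(7)])
  have "0 \<le> L * norm (b - a)" using assms(10) unfolding L_def by (metis abs_ge_zero)
  then have L: "0 \<le> L" using assms(9) by (simp add: zero_le_mult_iff)
  have sp: "s * p < p" using assms(3,4) by simp
  have weak: "(\<integral>z. energy_form p (s * p) U \<phi> z \<partial>(lborel \<Otimes>\<^sub>M lborel)) = 0" if "\<phi> \<in> test_functions" for \<phi>
    by (rule weak_solution_energy_form[OF assms(8) lipschitz_continuous[OF U] that])
  have main: "\<exists>\<xi> c. \<forall>x. U x = \<xi> \<bullet> x + c"
    if "0 < L" and ne: "a' \<noteq> b'" and "U b' - U a' = L * norm (b' - a')" for a' b'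
  proof -
    have "(1 / 3) *\<^sub>R (b' - a') \<noteq> 0" using ne by simp
    from affine_if_extremal_translation[OF U L this extremal_translation[OF assms(4,5,6) sp weak U that]]
    show ?thesis by blast
  qed
  show ?thesis
  \<comment> \<open>For L = 0 the function is constant. For L > 0 the touching paraboloids have
    slope of norm L and hence nonzero; interchanging \<open>a\<close> and \<open>b\<close> settles
    the sign in the absolute value.\<close>
  proof (cases "L = 0")
    case True
    then have "U x = 0 \<bullet> x + U 0" for x using U[of x 0] by simp
    then show ?thesis by blast
  next
    case False
    then have "0 < L" using L by simp
    moreover have "U b - U a = L * norm (b - a) \<or> U a - U b = L * norm (a - b)"
      using assms(10) by (auto simp: L_def abs_if norm_minus_commute split: if_splits)
    ultimately show ?thesis using main[of a b] main[of b a] assms(9) by blast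
  qed
qed

end
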